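(* Let $(I(t))_{t\ge0}$ be a family of operators $I(t)\colon C_\kappa\to C_\kappa$, let $(h_n)_{n\in\mathbb N}\subset(0,\infty)$ with $h_n\to0$, and let $\mathcal T\subset[0,\infty)$ be a countable dense set including zero. For $t\ge0$ and $n\in\mathbb N$ put $k_n^t:=\max\{k\in\mathbb N_0:kh_n\le t\}$ and $I(\pi_n^t)f:=I(h_n)^{k_n^t}f$. Suppose that: (1) $I(0)=\mathrm{id}_{C_\kappa}$. (2) $I(h_n)$ is convex and monotone with $I(h_n)0=0$ for all $n\in\mathbb N$. (3) There exists $\alpha\colon\mathbb R_+\times\mathbb R_+\to\mathbb R_+$, non-decreasing in the second argument, such that for every $r\ge0$ and $k,l,n\in\mathbb N$: $I(h_n)\colon B_{C_\kappa}(r)\to B_{C_\kappa}(\alpha(r,h_n))$ and $\alpha(\alpha(r,kh_n),lh_n)\le\alpha(r,(k+l)h_n)$. (4) For every $r\ge0$ there exists $\omega_r\ge0$ with $\|I(h_n)f-I(h_n)g\|_\kappa\le e^{h_n\omega_r}\|f-g\|_\kappa$ for all $n\in\mathbb N$ and $f,g\in B_{C_\kappa}(r)$; moreover $r\mapsto\omega_r$ is non-decreasing. (5) There exists a countable set $\mathcal D\subset\mathcal L_I$ such that $(I(\pi_n^t)f)_{n\in\mathbb N}$ is uniformly equicontinuous for all $(f,t)\in\mathcal D\times\mathcal T$ and, for every $f\in C_\kappa$, there exists $(f_n)_{n\in\mathbb N}\subset\mathcal D$ with $\sup_n\|f_n\|_\kappa\le\|f\|_\kappa$ and $f_n\to f$.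 (6) For every $\varepsilon>0$, $r,T\ge0$ and compact $K\subset X$ there exist a compact $K'\subset X$ and $c\ge0$ with $\|I(\pi_n^t)f-I(\pi_n^t)g\|_{\infty,K}\le c\|f-g\|_{\infty,K'}+\varepsilon$ for all $t\in[0,T]$, $n\in\mathbb N$ and $f,g\in B_{C_\kappa}(r)$. Then there exist a strongly continuous convex monotone semigroup $(S(t))_{t\ge0}$ on $C_\kappa$ with $S(t)0=0$ and a subsequence $(n_l)_{l\in\mathbb N}\subset\mathbb N$ such that $$S(t)f=\lim_{l\to\infty}I(\pi_{n_l}^t)f\quad\text{for all }(f,t)\in C_\kappa\times\mathcal T.$$ Furthermore, with $A$ denoting the generator of $(S(t))_{t\ge0}$: (i) $f\in D(A)$ and $Af=I'(0)f$ for all $f\in C_\kappa$ such that $I'(0)f\in C_\kappa$ exists. (ii) For every $r,t\ge0$ and $f,g\in B_{C_\kappa}(r)$: $\|S(t)f\|_\kappa\le\alpha(r,t)$ and $\|S(t)f-S(t)g\|_\kappa\le e^{t\omega_{\alpha(r,t)}}\|f-g\|_\kappa$. (iii) For every $\varepsilon>0$, $r,T\ge0$ and compact $K\subset X$ there exist a compact $K'\subset X$ and $c\ge0$ with $\|S(t)f-S(t)g\|_{\infty,K}\le c\|f-g\|_{\infty,K'}+\varepsilon$ for all $t\in[0,T]$ and $f,g\in B_{C_\kappa}(r)$. (iv) $\mathcal L_I\subset\mathcal L_S$ and $S(t)\colon\mathcal L_S\to\mathcal L_S$ for all $t\ge0$.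
   Context: $(X,d)$ is a complete separable metric space and $\kappa\colon X\to(0,\infty)$ is bounded and continuous. $\|f\|_\kappa:=\sup_{x}|f(x)|\kappa(x)$, $\|f\|_{\infty,K}:=\sup_{x\in K}|f(x)|$. $C_\kappa$ is the space of continuous $f\colon X\to\mathbb R$ with $\|f\|_\kappa<\infty$, ordered pointwise, and $B_{C_\kappa}(r)=\{f\in C_\kappa:\|f\|_\kappa\le r\}$. Convergence $f_n\to f$ in $C_\kappa$ (and every limit in $C_\kappa$) is in the mixed topology: $\sup_n\|f_n\|_\kappa<\infty$ and $\|f_n-f\|_{\infty,K}\to0$ for every compact $K\subset X$; limits as $h\downarrow0$ (or $t\to0$) are along all sequences. A sequence of functions $(f_n)$ is uniformly equicontinuous if for every $\varepsilon>0$ there is $\delta>0$ with $|f_n(x)-f_n(y)|<\varepsilon$ for all $n$ and all $x,y\in X$ with $d(x,y)<\delta$. $\mathcal L_I$ is the set of $f\in C_\kappa$ for which there are $c\ge0$, $t_0>0$ with $\|I(t)f-f\|_\kappa\le ct$ for all $t\in[0,t_0]$; $\mathcal L_S$ is defined likewise. $I'(0)f:=\lim_{h\downarrow0}\frac{I(h)f-f}{h}\in C_\kappa$ whenever the limit exists. The generator of $(S(t))$ is $Af:=\lim_{h\downarrow0}\frac{S(h)f-f}{h}\in C_\kappa$ with domain $D(A)$ all $f\in C_\kappa$ for which this limit exists. A convex monotone semigroup on $C_\kappa$ is a family of operators $S(t)\colon C_\kappa\to C_\kappa$, $t\ge0$, such that: (S1) each $S(t)$ is convex and monotone, and $S(t)f_n\downarrow0$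 pointwise whenever $(f_n)\subset C_\kappa$ decreases pointwise to $0$; (S2) $S(0)f=f$ and $S(s+t)f=S(s)S(t)f$; (S3) $\sup_{t\in[0,T]}\|S(t)\frac r\kappa\|_\kappa<\infty$ for all $r,T\ge0$; (S4) for all $t\ge0$, $f\in C_\kappa$: $\limsup_n(S(s_n)f)(x_n)\le(S(t)f)(x)$ for all $x\in X$ and all sequences $0\le s_n\to t$, $x_n\to x$. It is strongly continuous if $\lim_{t\to0}S(t)f=f$ for all $f\in C_\kappa$.
   Formalization: In (ii), the bound ‖S(t)f‖_κ ≤ α(r,t) is claimed at t=0 only when r ≤ α(r,0); for t>0 it is unconditional. As printed it can fail at t=0: X a point, κ=1, I(t)=id, α(r,0)=0, α(r,t)=r for t>0. *)

theory Defs
  imports "HOL-Analysis.Analysis"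
begin

text \<open>
  The state space is a type of class \<^class>\<open>polish_space\<close>.  Operators on the weighted space are
  total functions on \<open>'a \<Rightarrow> real\<close>; only their values on \<open>Ckappa \<kappa>\<close>, and only times \<open>t \<ge> 0\<close>,
  are ever referred to.
\<close>

definition kappa_norm :: "('a \<Rightarrow> real) \<Rightarrow> ('a \<Rightarrow> real) \<Rightarrow> real" where
  "kappa_norm \<kappa> f = (SUP x. \<bar>f x\<bar> * \<kappa> x)"

text \<open>Finiteness of the weighted norm has to be stated as boundedness of the set of values,
  because a real-valued supremum of an unbounded set is unspecified.\<close>

definition Ckappa :: "('a::topological_space \<Rightarrow> real) \<Rightarrow> ('a \<Rightarrow> real) set" where
  "Ckappa \<kappa> = {f. continuous_on UNIV f \<and> bdd_above (range (\<lambda>x. \<bar>f x\<bar> * \<kappa> x))}"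

definition Ckappa_ball :: "('a::topological_space \<Rightarrow> real) \<Rightarrow> real \<Rightarrow> ('a \<Rightarrow> real) set" where
  "Ckappa_ball \<kappa> r = {f \<in> Ckappa \<kappa>. kappa_norm \<kappa> f \<le> r}"

text \<open>The supremum over the empty set is \<open>0\<close>.\<close>

definition sup_norm_on :: "'a set \<Rightarrow> ('a \<Rightarrow> real) \<Rightarrow> real" where
  "sup_norm_on K f = (if K = {} then 0 else SUP x\<in>K. \<bar>f x\<bar>)"

definition mixed_lim ::
    "('a::topological_space \<Rightarrow> real) \<Rightarrow> (nat \<Rightarrow> 'a \<Rightarrow> real) \<Rightarrow> ('a \<Rightarrow> real) \<Rightarrow> bool" where
  "mixed_lim \<kappa> F f \<longleftrightarrow>
     (\<forall>n. F n \<in> Ckappa \<kappa>) \<and> f \<in> Ckappa \<kappa> \<and>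
     bdd_above (range (\<lambda>n. kappa_norm \<kappa> (F n))) \<and>
     (\<forall>K. compact K \<longrightarrow> (\<lambda>n. sup_norm_on K (\<lambda>x. F n x - f x)) \<longlonglongrightarrow> 0)"

definition unif_equicontinuous :: "(nat \<Rightarrow> 'a::metric_space \<Rightarrow> real) \<Rightarrow> bool" where
  "unif_equicontinuous F \<longleftrightarrow>
     (\<forall>\<epsilon>>0. \<exists>\<delta>>0. \<forall>n x y. dist x y < \<delta> \<longrightarrow> \<bar>F n x - F n y\<bar> < \<epsilon>)"

definition convex_operator ::
    "('a::topological_space \<Rightarrow> real) \<Rightarrow> (('a \<Rightarrow> real) \<Rightarrow> 'a \<Rightarrow> real) \<Rightarrow> bool" where
  "convex_operator \<kappa> \<Phi> \<longleftrightarrow>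
     (\<forall>f\<in>Ckappa \<kappa>. \<forall>g\<in>Ckappa \<kappa>. \<forall>c\<in>{0..1}. \<forall>x.
        \<Phi> (\<lambda>y. c * f y + (1 - c) * g y) x \<le> c * \<Phi> f x + (1 - c) * \<Phi> g x)"

definition monotone_operator ::
    "('a::topological_space \<Rightarrow> real) \<Rightarrow> (('a \<Rightarrow> real) \<Rightarrow> 'a \<Rightarrow> real) \<Rightarrow> bool" where
  "monotone_operator \<kappa> \<Phi> \<longleftrightarrow> mono_on (Ckappa \<kappa>) \<Phi>"

definition decreases_to_0 :: "(nat \<Rightarrow> 'a \<Rightarrow> real) \<Rightarrow> bool" where
  "decreases_to_0 F \<longleftrightarrow> (\<forall>x. decseq (\<lambda>n. F n x) \<and> (\<lambda>n. F n x) \<longlonglongrightarrow> 0)"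

definition operator_family ::
    "('a::topological_space \<Rightarrow> real) \<Rightarrow> (real \<Rightarrow> ('a \<Rightarrow> real) \<Rightarrow> 'a \<Rightarrow> real) \<Rightarrow> bool" where
  "operator_family \<kappa> S \<longleftrightarrow> (\<forall>t\<ge>0. \<forall>f\<in>Ckappa \<kappa>. S t f \<in> Ckappa \<kappa>)"

definition convex_monotone_semigroup ::
    "('a::topological_space \<Rightarrow> real) \<Rightarrow> (real \<Rightarrow> ('a \<Rightarrow> real) \<Rightarrow> 'a \<Rightarrow> real) \<Rightarrow> bool" where
  "convex_monotone_semigroup \<kappa> S \<longleftrightarrow>
     operator_family \<kappa> S \<and>
     (\<forall>t\<ge>0. convex_operator \<kappa> (S t) \<and> monotone_operator \<kappa> (S t) \<and>
        (\<forall>F. (\<forall>n. F n \<in> Ckappa \<kappa>) \<and> decreases_to_0 F \<longrightarrow> decreases_to_0 (\<lambda>n. S t (F n)))) \<and>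
     (\<forall>f\<in>Ckappa \<kappa>. S 0 f = f) \<and>
     (\<forall>s\<ge>0. \<forall>t\<ge>0. \<forall>f\<in>Ckappa \<kappa>. S (s + t) f = S s (S t f)) \<and>
     (\<forall>r\<ge>0. \<forall>T\<ge>0. bdd_above ((\<lambda>t. kappa_norm \<kappa> (S t (\<lambda>x. r / \<kappa> x))) ` {0..T})) \<and>
     (\<forall>t\<ge>0. \<forall>f\<in>Ckappa \<kappa>. \<forall>x s y. (\<forall>n. 0 \<le> s n) \<and> s \<longlonglongrightarrow> t \<and> y \<longlonglongrightarrow> x \<longrightarrow>
        limsup (\<lambda>n. ereal (S (s n) f (y n))) \<le> ereal (S t f x))"

definition strongly_continuous ::
    "('a::topological_space \<Rightarrow> real) \<Rightarrow> (real \<Rightarrow> ('a \<Rightarrow> real) \<Rightarrow> 'a \<Rightarrow> real) \<Rightarrow> bool" where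
  "strongly_continuous \<kappa> S \<longleftrightarrow>
     (\<forall>f\<in>Ckappa \<kappa>. \<forall>t::nat \<Rightarrow> real. (\<forall>n. 0 \<le> t n) \<and> t \<longlonglongrightarrow> 0 \<longrightarrow> mixed_lim \<kappa> (\<lambda>n. S (t n) f) f)"

text \<open>\<open>has_deriv0 \<kappa> I f g\<close>: the limit of \<open>(I h f - f) / h\<close> as \<open>h\<close> decreases to \<open>0\<close> exists in the
  mixed topology and equals \<open>g\<close>; such a \<open>g\<close> is unique.\<close>

definition has_deriv0 ::
    "('a::topological_space \<Rightarrow> real) \<Rightarrow> (real \<Rightarrow> ('a \<Rightarrow> real) \<Rightarrow> 'a \<Rightarrow> real) \<Rightarrow>
     ('a \<Rightarrow> real) \<Rightarrow> ('a \<Rightarrow> real) \<Rightarrow> bool" where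
  "has_deriv0 \<kappa> I f g \<longleftrightarrow>
     (\<forall>h::nat \<Rightarrow> real. (\<forall>n. 0 < h n) \<and> h \<longlonglongrightarrow> 0 \<longrightarrow>
        mixed_lim \<kappa> (\<lambda>n x. (I (h n) f x - f x) / h n) g)"

definition deriv0 ::
    "('a::topological_space \<Rightarrow> real) \<Rightarrow> (real \<Rightarrow> ('a \<Rightarrow> real) \<Rightarrow> 'a \<Rightarrow> real) \<Rightarrow>
     ('a \<Rightarrow> real) \<Rightarrow> 'a \<Rightarrow> real" where
  "deriv0 \<kappa> I f = (THE g. has_deriv0 \<kappa> I f g)"

definition generator_domain ::
    "('a::topological_space \<Rightarrow> real) \<Rightarrow> (real \<Rightarrow> ('a \<Rightarrow> real) \<Rightarrow> 'a \<Rightarrow> real) \<Rightarrow>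
     ('a \<Rightarrow> real) set" where
  "generator_domain \<kappa> S = {f \<in> Ckappa \<kappa>. \<exists>g. has_deriv0 \<kappa> S f g}"

definition generator ::
    "('a::topological_space \<Rightarrow> real) \<Rightarrow> (real \<Rightarrow> ('a \<Rightarrow> real) \<Rightarrow> 'a \<Rightarrow> real) \<Rightarrow>
     ('a \<Rightarrow> real) \<Rightarrow> 'a \<Rightarrow> real" where
  "generator \<kappa> S f = deriv0 \<kappa> S f"

definition Lipschitz_set ::
    "('a::topological_space \<Rightarrow> real) \<Rightarrow> (real \<Rightarrow> ('a \<Rightarrow> real) \<Rightarrow> 'a \<Rightarrow> real) \<Rightarrow>
     ('a \<Rightarrow> real) set" where
  "Lipschitz_set \<kappa> I =
     {f \<in> Ckappa \<kappa>. \<exists>c\<ge>0. \<exists>t\<^sub>0>0. \<forall>t\<in>{0..t\<^sub>0}. kappa_norm \<kappa> (\<lambda>x. I t f x - f x) \<le> c * t}"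

definition num_steps :: "real \<Rightarrow> real \<Rightarrow> nat" where
  "num_steps h t = Max {k::nat. real k * h \<le> t}"

text \<open>\<open>iterate I h t f\<close> is \<open>I(\<pi>\<^sub>n\<^sup>t) f\<close> for the step size \<open>h = h\<^sub>n\<close>.\<close>

definition iterate ::
    "(real \<Rightarrow> ('a \<Rightarrow> real) \<Rightarrow> 'a \<Rightarrow> real) \<Rightarrow> real \<Rightarrow> real \<Rightarrow> ('a \<Rightarrow> real) \<Rightarrow> 'a \<Rightarrow> real" where
  "iterate I h t f = (I h ^^ num_steps h t) f"

end

theory Submission
  imports Defs "HOL-Complex_Analysis.Great_Picard"
begin

text \<open>
  Write \<open>J n k\<close> for the \<open>k\<close>-fold iterate of \<open>I (h n)\<close>.  Convergence is uniform convergence on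
  compact sets of sequences that are bounded in the weighted norm, and the argument rests on two
  kinds of estimates for the iterates that hold uniformly in \<open>n\<close>.

  Stability: as long as \<open>k * h n \<le> T\<close>, the operators \<open>J n k\<close> map a ball into a fixed ball and are
  Lipschitz there with a common constant (\<open>J_radius\<close>, \<open>J_lipschitz_radius\<close>).  Hence the iterates of a
  function whose first increment is of order \<open>h n\<close> are Lipschitz in time
  (\<open>J_time_Lipschitz\<close>).  Tightness: on balls, the operators \<open>J n k\<close> are equicontinuous for
  uniform convergence on compact sets (\<open>J_equicontinuous\<close>).

  Existence.  A diagonal argument over the countable set \<open>\<D> \<times> \<T> \<times> Q\<close>, with \<open>Q\<close> dense in the state
  space, gives a subsequence along which the iterates converge pointwise on \<open>Q\<close>.  Convergence
  then spreads in three steps: equicontinuity in space carries it from \<open>Q\<close> to compact sets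
  (\<open>equicontinuous_imp_uniformly_Cauchy\<close>), the Lipschitz estimate in time from \<open>\<T>\<close> to all
  \<open>t \<ge> 0\<close> (\<open>iterates_Cauchy_all_times\<close>), and tightness from \<open>\<D>\<close> to all functions
  (\<open>iterates_Cauchy_all_functions\<close>).  So \<open>S t f\<close> is the limit of the iterates for every
  time and every function, and monotonicity, convexity and all norm and tightness bounds
  pass to the limit.  The semigroup law holds on \<open>\<D>\<close> because step counts are additive up to one
  step, and then everywhere by continuity (\<open>S_semigroup\<close>).  Tightness also yields joint
  continuity in time and space and, with Dini's theorem, continuity from above.

  Generator.  If \<open>I (h n) f = f + h n * q\<close> with \<open>q\<close> close to \<open>g\<close>, convexity bounds the increment
  \<open>J n k (f + h n * q) - J n k f\<close> by \<open>h n\<close> times \<open>J n k (f + q) - J n k f\<close> from above and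
  by \<open>h n\<close> times \<open>J n k f - J n k (f - q)\<close> from below (\<open>J_increment_bounds\<close>).  For small times
  both are close to \<open>g\<close> on compact sets, by tightness and continuity at time \<open>0\<close>.
  Summing the increments shows \<open>J n k f - f = k * h n * (g + small)\<close> uniformly in \<open>n\<close>
  (\<open>J_first_order\<close>), and the limit in \<open>n\<close> gives the derivative of \<open>S t f\<close> at \<open>0\<close>.
\<close>

section \<open>Step counts\<close>

lemma num_steps_mult:
  assumes "0 < h"
  shows "num_steps h (real k * h) = k"
proof -
  have "{j::nat. real j * h \<le> real k * h} = {..k}"
    using assms by auto
  then show ?thesis
    by (simp add: num_steps_def Max_eq_iff)
qed

lemma num_steps_bounds:
  assumes "0 < h" "0 \<le> t"
  shows "real (num_steps h t) * h \<le> t" "t < real (num_steps h t) * h + h"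
proof -
  define m where "m = nat \<lfloor>t / h\<rfloor>"
  have m: "real j * h \<le> t \<longleftrightarrow> j \<le> m" for j
    using assms by (simp add: m_def le_nat_iff le_floor_iff pos_le_divide_eq)
  have "{j::nat. real j * h \<le> t} = {..m}"
    using m by auto
  then have N: "num_steps h t = m"
    by (simp add: num_steps_def Max_eq_iff)
  show "real (num_steps h t) * h \<le> t"
    using m N by simp
  show "t < real (num_steps h t) * h + h"
    using m[of "Suc m"] N by (simp add: algebra_simps)
qed

lemma num_steps_0: "0 < h \<Longrightarrow> num_steps h 0 = 0"
  using num_steps_mult[of h 0] by simp

section \<open>Uniform convergence on compact sets\<close>

lemma uniformly_Cauchy_on_approx:
  fixes u :: "nat \<Rightarrow> 'a \<Rightarrow> 'b::metric_space"
  assumes "\<And>\<epsilon>. 0 < \<epsilon> \<Longrightarrow>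
    \<exists>v N. uniformly_Cauchy_on K v \<and> (\<forall>n\<ge>N. \<forall>x\<in>K. dist (u n x) (v n x) \<le> \<epsilon>)"
  shows "uniformly_Cauchy_on K u"
proof (rule uniformly_Cauchy_onI)
  fix e :: real assume e: "0 < e"
  then obtain v N where v: "uniformly_Cauchy_on K v"
    and N: "\<And>n x. n \<ge> N \<Longrightarrow> x \<in> K \<Longrightarrow> dist (u n x) (v n x) \<le> e / 3"
    using assms[of "e / 3"] by auto
  from v e obtain M where M: "\<And>x m n. x \<in> K \<Longrightarrow> m \<ge> M \<Longrightarrow> n \<ge> M \<Longrightarrow> dist (v m x) (v n x) < e / 3"
    unfolding uniformly_Cauchy_on_def by (metis zero_less_divide_iff zero_less_numeral)
  have "dist (u m x) (u n x) < e" if "x \<in> K" "m \<ge> max M N" "n \<ge> max M N" for x m n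
  proof -
    have "dist (u m x) (u n x) \<le> dist (u m x) (v m x) + dist (v m x) (v n x) + dist (u n x) (v n x)"
      by (metis add_mono dist_commute dist_triangle dist_triangle2 dist_triangle_le order_refl)
    then show ?thesis
      using M[of x m n] N[of m x] N[of n x] that by simp
  qed
  then show "\<exists>M. \<forall>x\<in>K. \<forall>m\<ge>M. \<forall>n\<ge>M. dist (u m x) (u n x) < e"
    by blast
qed

text \<open>The Arzela-Ascoli mechanism: finitely many points of \<open>Q\<close> are \<open>\<delta>\<close>-close to all of \<open>K\<close>, and the
  Cauchy indices of these points serve for the whole of \<open>K\<close>.\<close>

lemma equicontinuous_imp_uniformly_Cauchy:
  fixes F :: "nat \<Rightarrow> 'a::metric_space \<Rightarrow> real"
  assumes equi: "unif_equicontinuous F"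
    and dense: "\<And>U. open U \<Longrightarrow> U \<noteq> {} \<Longrightarrow> \<exists>q\<in>Q. q \<in> U"
    and conv: "\<And>q. q \<in> Q \<Longrightarrow> convergent (\<lambda>n. F n q)"
    and K: "compact K"
  shows "uniformly_Cauchy_on K F"
proof (rule uniformly_Cauchy_onI)
  fix e :: real assume e: "0 < e"
  then obtain \<delta> where \<delta>: "0 < \<delta>" "\<And>n x y. dist x y < \<delta> \<Longrightarrow> \<bar>F n x - F n y\<bar> < e / 3"
    using equi unfolding unif_equicontinuous_def by (metis zero_less_divide_iff zero_less_numeral)
  have "K \<subseteq> (\<Union>q\<in>Q. ball q \<delta>)"
  proof
    fix x assume "x \<in> K"
    obtain q where "q \<in> Q" "q \<in> ball x \<delta>"
      using dense[of "ball x \<delta>"] \<delta>(1) by auto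
    then show "x \<in> (\<Union>q\<in>Q. ball q \<delta>)"
      by (auto simp: dist_commute)
  qed
  then obtain C where C: "C \<subseteq> Q" "finite C" "K \<subseteq> (\<Union>q\<in>C. ball q \<delta>)"
    using K by (rule_tac compactE_image[of K Q "\<lambda>q. ball q \<delta>"]) auto
  have "\<exists>N. \<forall>m\<ge>N. \<forall>n\<ge>N. dist (F m q) (F n q) < e / 3" if "q \<in> C" for q
  proof -
    have "Cauchy (\<lambda>n. F n q)"
      using conv[of q] C(1) that by (auto intro: convergent_Cauchy)
    then show ?thesis
      using e metric_CauchyD[of "\<lambda>n. F n q" "e / 3"] by simp
  qed
  then obtain N where N: "\<And>q m n. q \<in> C \<Longrightarrow> m \<ge> N q \<Longrightarrow> n \<ge> N q \<Longrightarrow> dist (F m q) (F n q) < e / 3"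
    by metis
  have "dist (F m x) (F n x) < e"
    if x: "x \<in> K" and mn: "m \<ge> sum N C" "n \<ge> sum N C" for x m n
  proof -
    from x C obtain q where q: "q \<in> C" "dist x q < \<delta>"
      by (auto simp: dist_commute)
    have "N q \<le> sum N C"
      using q C(2) by (simp add: member_le_sum)
    then have "\<bar>F m q - F n q\<bar> < e / 3"
      using N[OF q(1), of m n] mn by (simp add: dist_real_def)
    then show ?thesis
      using \<delta>(2)[OF q(2), of m] \<delta>(2)[OF q(2), of n] unfolding dist_real_def by linarith
  qed
  then show "\<exists>M. \<forall>x\<in>K. \<forall>m\<ge>M. \<forall>n\<ge>M. dist (F m x) (F n x) < e"
    by blast
qed

lemma compact_insert_limit_range:
  fixes y :: "nat \<Rightarrow> 'a::metric_space"
  assumes "y \<longlonglongrightarrow> x"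
  shows "compact (insert x (range y))"
  using compactin_sequence_with_limit[of euclidean y x "range y"] assms
  by (simp add: limitin_canonical_iff)

lemma continuous_on_UNIV_sequentiallyI:
  fixes f :: "'a::metric_space \<Rightarrow> 'b::topological_space"
  assumes "\<And>y x. y \<longlonglongrightarrow> x \<Longrightarrow> (\<lambda>n. f (y n)) \<longlonglongrightarrow> f x"
  shows "continuous_on UNIV f"
  using assms by (simp add: continuous_on_sequentially comp_def)

text \<open>A convergent sequence together with its limit is compact, so uniform convergence on compact
  sets preserves sequential continuity.\<close>

lemma continuous_on_limit_on_compacts:
  fixes F :: "nat \<Rightarrow> 'a::metric_space \<Rightarrow> real"
  assumes F: "\<And>n. continuous_on UNIV (F n)"
    and lim: "\<And>K. compact K \<Longrightarrow> uniform_limit K F f sequentially"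
  shows "continuous_on UNIV f"
proof (rule continuous_on_UNIV_sequentiallyI)
  fix y :: "nat \<Rightarrow> 'a" and x assume y: "y \<longlonglongrightarrow> x"
  let ?K = "insert x (range y)"
  have "continuous_on ?K f"
    by (rule uniform_limit_theorem[OF _ lim[OF compact_insert_limit_range[OF y]]])
      (auto intro: always_eventually continuous_on_subset[OF F])
  then show "(\<lambda>n. f (y n)) \<longlonglongrightarrow> f x"
    by (rule continuous_on_tendsto_compose[OF _ y]) auto
qed

text \<open>Dini's theorem: the open sets where \<open>F n < e\<close> increase to the whole space, so one of them
  contains \<open>K\<close>.\<close>

lemma decreases_to_0_imp_uniform_limit:
  fixes F :: "nat \<Rightarrow> 'a::topological_space \<Rightarrow> real"
  assumes F: "\<And>n. continuous_on UNIV (F n)" and dec: "decreases_to_0 F" and K: "compact K"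
  shows "uniform_limit K F (\<lambda>x. 0) sequentially"
proof (rule uniform_limitI)
  fix e :: real assume e: "0 < e"
  have pos: "0 \<le> F n x" for n x
    using dec decseq_ge[of "\<lambda>n. F n x" 0 n] by (auto simp: decreases_to_0_def)
  have anti: "F n x \<le> F m x" if "m \<le> n" for m n x
    using dec that by (auto simp: decreases_to_0_def decseq_def)
  have op: "open {x. F n x < e}" for n
    by (intro open_Collect_less F continuous_on_const)
  have "K \<subseteq> (\<Union>n\<in>UNIV. {x. F n x < e})"
  proof
    fix x
    have "(\<lambda>n. F n x) \<longlonglongrightarrow> 0"
      using dec by (simp add: decreases_to_0_def)
    then have "\<forall>\<^sub>F n in sequentially. F n x < e"
      using e by (rule order_tendstoD)
    then show "x \<in> (\<Union>n\<in>UNIV. {x. F n x < e})"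
      by (auto simp: eventually_sequentially)
  qed
  then obtain C where C: "finite C" "K \<subseteq> (\<Union>n\<in>C. {x. F n x < e})"
    using K op by (rule_tac compactE_image[of K UNIV "\<lambda>n. {x. F n x < e}"]) auto
  show "\<forall>\<^sub>F n in sequentially. \<forall>x\<in>K. dist (F n x) 0 < e"
    unfolding eventually_sequentially
  proof (intro exI[of _ "Max (insert 0 C)"] allI impI ballI)
    fix n x assume n: "Max (insert 0 C) \<le> n" and x: "x \<in> K"
    obtain m where m: "m \<in> C" "F m x < e"
      using C x by auto
    have "m \<le> n"
      using n m C(1) by (meson Max_ge finite.insertI insertCI le_trans)
    then show "dist (F n x) 0 < e"
      using anti[of m n x] m pos[of n x] by simp
  qed
qed

lemma sup_norm_on_upper:
  fixes f :: "'a::topological_space \<Rightarrow> real"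
  assumes "compact K" "continuous_on UNIV f" "x \<in> K"
  shows "\<bar>f x\<bar> \<le> sup_norm_on K f"
proof -
  have "compact ((\<lambda>x. \<bar>f x\<bar>) ` K)"
    by (intro compact_continuous_image continuous_intros continuous_on_subset[OF assms(2)] assms(1)) auto
  then have "bdd_above ((\<lambda>x. \<bar>f x\<bar>) ` K)"
    by (intro bounded_imp_bdd_above compact_imp_bounded)
  then show ?thesis
    using assms(3) by (auto simp: sup_norm_on_def intro: cSUP_upper)
qed

lemma sup_norm_on_least:
  assumes "0 \<le> c" "\<And>x. x \<in> K \<Longrightarrow> \<bar>f x\<bar> \<le> c"
  shows "sup_norm_on K f \<le> c"
  using assms by (auto simp: sup_norm_on_def intro!: cSUP_least)

lemma sup_norm_on_nonneg:
  fixes f :: "'a::topological_space \<Rightarrow> real"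
  assumes "compact K" "continuous_on UNIV f"
  shows "0 \<le> sup_norm_on K f"
proof (cases "K = {}")
  case False
  then show ?thesis
    using sup_norm_on_upper[OF assms] abs_ge_zero order_trans by blast
qed (simp add: sup_norm_on_def)

lemma sup_norm_on_tendsto_0_iff:
  fixes F :: "nat \<Rightarrow> 'a::topological_space \<Rightarrow> real"
  assumes "compact K" "\<And>n. continuous_on UNIV (F n)" "continuous_on UNIV f"
  shows "(\<lambda>n. sup_norm_on K (\<lambda>x. F n x - f x)) \<longlonglongrightarrow> 0 \<longleftrightarrow> uniform_limit K F f sequentially"
proof -
  have cont: "continuous_on UNIV (\<lambda>x. F n x - f x)" for n
    by (intro continuous_intros assms)
  note up = sup_norm_on_upper[OF assms(1) cont] and pos = sup_norm_on_nonneg[OF assms(1) cont]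
  show ?thesis
  proof
    assume L: "(\<lambda>n. sup_norm_on K (\<lambda>x. F n x - f x)) \<longlonglongrightarrow> 0"
    show "uniform_limit K F f sequentially"
    proof (rule uniform_limitI)
      fix e :: real assume "0 < e"
      with L have "\<forall>\<^sub>F n in sequentially. sup_norm_on K (\<lambda>x. F n x - f x) < e"
        by (rule order_tendstoD)
      then show "\<forall>\<^sub>F n in sequentially. \<forall>x\<in>K. dist (F n x) (f x) < e"
        by eventually_elim (use up in \<open>auto simp: dist_real_def intro: le_less_trans\<close>)
    qed
  next
    assume U: "uniform_limit K F f sequentially"
    show "(\<lambda>n. sup_norm_on K (\<lambda>x. F n x - f x)) \<longlonglongrightarrow> 0"
    proof (rule tendstoI)
      fix e :: real assume "0 < e"
      then have "\<forall>\<^sub>F n in sequentially. \<forall>x\<in>K. dist (F n x) (f x) < e / 2"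
        using uniform_limitD[OF U, of "e / 2"] by simp
      then show "\<forall>\<^sub>F n in sequentially. dist (sup_norm_on K (\<lambda>x. F n x - f x)) 0 < e"
      proof eventually_elim
        case (elim n)
        have "sup_norm_on K (\<lambda>x. F n x - f x) \<le> e / 2"
          using \<open>0 < e\<close> elim by (intro sup_norm_on_least) (auto simp: dist_real_def less_imp_le)
        then show ?case
          using pos[of n] \<open>0 < e\<close> by simp
      qed
    qed
  qed
qed

section \<open>Weighted spaces of continuous functions\<close>

locale weight =
  fixes \<kappa> :: "'a::metric_space \<Rightarrow> real"
  assumes kappa_pos: "0 < \<kappa> x"
    and kappa_cont: "continuous_on UNIV \<kappa>"
begin

lemma kappa_nonneg [simp]: "0 \<le> \<kappa> x"
  using kappa_pos[of x] by simp

lemma kappa_norm_upper: "f \<in> Ckappa \<kappa> \<Longrightarrow> \<bar>f x\<bar> * \<kappa> x \<le> kappa_norm \<kappa> f"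
  unfolding kappa_norm_def Ckappa_def by (auto intro: cSUP_upper)

lemma kappa_norm_least: "(\<And>x. \<bar>f x\<bar> * \<kappa> x \<le> c) \<Longrightarrow> kappa_norm \<kappa> f \<le> c"
  unfolding kappa_norm_def by (auto intro: cSUP_least)

lemma kappa_norm_nonneg: "f \<in> Ckappa \<kappa> \<Longrightarrow> 0 \<le> kappa_norm \<kappa> f"
  using kappa_norm_upper[of f] by (meson abs_ge_zero kappa_nonneg mult_nonneg_nonneg order_trans)

text \<open>Membership in a ball as a pointwise bound, which also covers finiteness of the norm; nearly all
  norm estimates below are carried out pointwise in this form.\<close>

lemma Ckappa_ball_iff:
  "f \<in> Ckappa_ball \<kappa> r \<longleftrightarrow> continuous_on UNIV f \<and> (\<forall>x. \<bar>f x\<bar> * \<kappa> x \<le> r)"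
proof
  assume "f \<in> Ckappa_ball \<kappa> r"
  then show "continuous_on UNIV f \<and> (\<forall>x. \<bar>f x\<bar> * \<kappa> x \<le> r)"
    using kappa_norm_upper[of f] order_trans by (auto simp: Ckappa_ball_def Ckappa_def)
next
  assume R: "continuous_on UNIV f \<and> (\<forall>x. \<bar>f x\<bar> * \<kappa> x \<le> r)"
  then have "bdd_above (range (\<lambda>x. \<bar>f x\<bar> * \<kappa> x))"
    by (intro bdd_aboveI[of _ r]) auto
  with R show "f \<in> Ckappa_ball \<kappa> r"
    by (auto simp: Ckappa_ball_def Ckappa_def intro: kappa_norm_least)
qed

lemma ball_Ckappa: "f \<in> Ckappa_ball \<kappa> r \<Longrightarrow> f \<in> Ckappa \<kappa>"
  by (simp add: Ckappa_ball_def)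

lemma ball_bound: "f \<in> Ckappa_ball \<kappa> r \<Longrightarrow> \<bar>f x\<bar> * \<kappa> x \<le> r"
  by (simp add: Ckappa_ball_iff)

lemma ball_nonneg: "f \<in> Ckappa_ball \<kappa> r \<Longrightarrow> 0 \<le> r"
  using ball_bound[of f r undefined] kappa_nonneg[of undefined]
  by (meson abs_ge_zero mult_nonneg_nonneg order_trans)

lemma ball_mono: "f \<in> Ckappa_ball \<kappa> r \<Longrightarrow> r \<le> s \<Longrightarrow> f \<in> Ckappa_ball \<kappa> s"
  by (simp add: Ckappa_ball_def)

lemma Ckappa_in_ball: "f \<in> Ckappa \<kappa> \<Longrightarrow> f \<in> Ckappa_ball \<kappa> (kappa_norm \<kappa> f)"
  by (simp add: Ckappa_ball_def)

lemma Ckappa_cont: "f \<in> Ckappa \<kappa> \<Longrightarrow> continuous_on UNIV f"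
  by (simp add: Ckappa_def)

lemma ball_add:
  assumes "f \<in> Ckappa_ball \<kappa> r" "g \<in> Ckappa_ball \<kappa> s"
  shows "(\<lambda>x. f x + g x) \<in> Ckappa_ball \<kappa> (r + s)"
proof -
  have "\<bar>f x + g x\<bar> * \<kappa> x \<le> r + s" for x
  proof -
    have "\<bar>f x + g x\<bar> * \<kappa> x \<le> (\<bar>f x\<bar> + \<bar>g x\<bar>) * \<kappa> x"
      by (intro mult_right_mono) auto
    also have "\<dots> \<le> r + s"
      using ball_bound[OF assms(1), of x] ball_bound[OF assms(2), of x] by (simp add: algebra_simps)
    finally show ?thesis .
  qed
  then show ?thesis
    using assms by (auto simp: Ckappa_ball_iff intro!: continuous_intros)
qed

lemma ball_scale:
  assumes "f \<in> Ckappa_ball \<kappa> r"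
  shows "(\<lambda>x. c * f x) \<in> Ckappa_ball \<kappa> (\<bar>c\<bar> * r)"
  using assms by (auto simp: Ckappa_ball_iff abs_mult mult.assoc intro!: continuous_intros mult_left_mono)

lemma ball_uminus: "f \<in> Ckappa_ball \<kappa> r \<Longrightarrow> (\<lambda>x. - f x) \<in> Ckappa_ball \<kappa> r"
  using ball_scale[of f r "-1"] by simp

lemma ball_diff:
  "f \<in> Ckappa_ball \<kappa> r \<Longrightarrow> g \<in> Ckappa_ball \<kappa> s \<Longrightarrow> (\<lambda>x. f x - g x) \<in> Ckappa_ball \<kappa> (r + s)"
  using ball_add[OF _ ball_uminus, of f r g s] by simp

lemma Ckappa_add: "f \<in> Ckappa \<kappa> \<Longrightarrow> g \<in> Ckappa \<kappa> \<Longrightarrow> (\<lambda>x. f x + g x) \<in> Ckappa \<kappa>"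
  by (blast intro: ball_Ckappa ball_add Ckappa_in_ball)

lemma Ckappa_diff: "f \<in> Ckappa \<kappa> \<Longrightarrow> g \<in> Ckappa \<kappa> \<Longrightarrow> (\<lambda>x. f x - g x) \<in> Ckappa \<kappa>"
  by (blast intro: ball_Ckappa ball_diff Ckappa_in_ball)

lemma Ckappa_scale: "f \<in> Ckappa \<kappa> \<Longrightarrow> (\<lambda>x. c * f x) \<in> Ckappa \<kappa>"
  by (blast intro: ball_Ckappa ball_scale Ckappa_in_ball)

lemma Ckappa_convex_comb:
  "f \<in> Ckappa \<kappa> \<Longrightarrow> g \<in> Ckappa \<kappa> \<Longrightarrow> (\<lambda>x. c * f x + d * g x) \<in> Ckappa \<kappa>"
  by (intro Ckappa_add Ckappa_scale)

lemma zero_in_Ckappa: "(\<lambda>x. 0) \<in> Ckappa \<kappa>"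
  by (rule ball_Ckappa[of _ 0]) (simp add: Ckappa_ball_iff)

text \<open>On a compact set the weight stays away from \<open>0\<close>, so smallness in the weighted norm implies
  uniform smallness there.\<close>

lemma compact_kappa_lower:
  assumes "compact K"
  obtains a where "0 < a" "\<And>x. x \<in> K \<Longrightarrow> a \<le> \<kappa> x"
proof (cases "K = {}")
  case True
  then show ?thesis
    using that[of 1] by simp
next
  case False
  then obtain x where "x \<in> K" "\<And>y. y \<in> K \<Longrightarrow> \<kappa> x \<le> \<kappa> y"
    using continuous_attains_inf[OF assms False continuous_on_subset[OF kappa_cont]] by auto
  then show ?thesis
    using that[of "\<kappa> x"] kappa_pos by blast
qed

lemma mixed_lim_iff:
  "mixed_lim \<kappa> F f \<longleftrightarrow> (\<exists>r. \<forall>n. F n \<in> Ckappa_ball \<kappa> r) \<and> f \<in> Ckappa \<kappa> \<and>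
     (\<forall>K. compact K \<longrightarrow> uniform_limit K F f sequentially)"
proof -
  have "(\<exists>r. \<forall>n. F n \<in> Ckappa_ball \<kappa> r) \<longleftrightarrow>
      (\<forall>n. F n \<in> Ckappa \<kappa>) \<and> bdd_above (range (\<lambda>n. kappa_norm \<kappa> (F n)))"
    by (auto simp: Ckappa_ball_def bdd_above_def)
  moreover have "(\<lambda>n. sup_norm_on K (\<lambda>x. F n x - f x)) \<longlonglongrightarrow> 0 \<longleftrightarrow> uniform_limit K F f sequentially"
    if "\<forall>n. F n \<in> Ckappa \<kappa>" "f \<in> Ckappa \<kappa>" "compact K" for K
    using that by (intro sup_norm_on_tendsto_0_iff) (auto intro: Ckappa_cont)
  ultimately show ?thesis
    unfolding mixed_lim_def by (intro iffI conjI) simp_all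
qed

lemma mixed_lim_uniform: "mixed_lim \<kappa> F f \<Longrightarrow> compact K \<Longrightarrow> uniform_limit K F f sequentially"
  by (simp add: mixed_lim_iff)

lemma mixed_lim_Ckappa: "mixed_lim \<kappa> F f \<Longrightarrow> f \<in> Ckappa \<kappa>" "mixed_lim \<kappa> F f \<Longrightarrow> F n \<in> Ckappa \<kappa>"
  by (simp_all add: mixed_lim_def)

lemma mixed_lim_tendsto: "mixed_lim \<kappa> F f \<Longrightarrow> (\<lambda>n. F n x) \<longlonglongrightarrow> f x"
  by (rule tendsto_uniform_limitI[OF mixed_lim_uniform[of F f "{x}"]]) auto

lemma mixed_lim_unique: "mixed_lim \<kappa> F f \<Longrightarrow> mixed_lim \<kappa> F g \<Longrightarrow> f = g"
  by (rule ext, rule LIMSEQ_unique[OF mixed_lim_tendsto mixed_lim_tendsto])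

text \<open>The limit inherits continuity and the weighted bound, so its membership in the space comes with
  the convergence.\<close>

lemma mixed_limI:
  assumes F: "\<And>n. F n \<in> Ckappa_ball \<kappa> r"
    and lim: "\<And>K. compact K \<Longrightarrow> uniform_limit K F f sequentially"
  shows "mixed_lim \<kappa> F f" "f \<in> Ckappa_ball \<kappa> r"
proof -
  have "continuous_on UNIV f"
    by (rule continuous_on_limit_on_compacts[OF Ckappa_cont[OF ball_Ckappa[OF F]] lim])
  moreover have "\<bar>f x\<bar> * \<kappa> x \<le> r" for x
  proof -
    have "(\<lambda>n. F n x) \<longlonglongrightarrow> f x"
      by (rule tendsto_uniform_limitI[OF lim[of "{x}"]]) auto
    then have "(\<lambda>n. \<bar>F n x\<bar> * \<kappa> x) \<longlonglongrightarrow> \<bar>f x\<bar> * \<kappa> x"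
      by (intro tendsto_intros)
    then show ?thesis
      by (rule LIMSEQ_le_const2) (use F ball_bound in blast)
  qed
  ultimately show f: "f \<in> Ckappa_ball \<kappa> r"
    unfolding Ckappa_ball_iff by blast
  show "mixed_lim \<kappa> F f"
    unfolding mixed_lim_iff using F lim ball_Ckappa[OF f] by (intro conjI exI[of _ r]) simp_all
qed

lemma mixed_lim_ball: "mixed_lim \<kappa> F f \<Longrightarrow> (\<And>n. F n \<in> Ckappa_ball \<kappa> r) \<Longrightarrow> f \<in> Ckappa_ball \<kappa> r"
  by (rule mixed_limI(2)) (auto intro: mixed_lim_uniform)

lemma weighted_diff_le_tendsto:
  assumes "\<And>x. (\<lambda>n. u n x) \<longlonglongrightarrow> f x" "\<And>x. (\<lambda>n. v n x) \<longlonglongrightarrow> g x" "c \<longlonglongrightarrow> C"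
    and "\<And>x. \<forall>\<^sub>F n in sequentially. \<bar>u n x - v n x\<bar> * \<kappa> x \<le> c n"
  shows "\<bar>f x - g x\<bar> * \<kappa> x \<le> C"
  by (rule tendsto_le[OF _ assms(3) _ assms(4)]) (auto intro!: tendsto_intros assms)

end

section \<open>Iterates of the one-step operators\<close>

text \<open>The hypotheses are inherited by subsequences of the step sizes \<open>h\<close>.  Results about a convergent
  subsequence are therefore proved for a scheme whose full sequence of iterates
  converges, and applied to the step sizes \<open>h (\<sigma> l)\<close>.\<close>

locale iteration_scheme = weight \<kappa> for \<kappa> :: "'a::metric_space \<Rightarrow> real" +
  fixes I :: "real \<Rightarrow> ('a \<Rightarrow> real) \<Rightarrow> 'a \<Rightarrow> real"
    and h :: "nat \<Rightarrow> real"
    and \<alpha> :: "real \<Rightarrow> real \<Rightarrow> real"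
    and \<omega> :: "real \<Rightarrow> real"
    and \<D> :: "('a \<Rightarrow> real) set"
  assumes I_maps: "operator_family \<kappa> I"
    and h_pos: "0 < h n"
    and h_lim: "h \<longlonglongrightarrow> 0"
    and I_convex: "convex_operator \<kappa> (I (h n))"
    and I_mono: "monotone_operator \<kappa> (I (h n))"
    and I_0: "I (h n) (\<lambda>x. 0) = (\<lambda>x. 0)"
    and alpha_nonneg: "0 \<le> r \<Longrightarrow> 0 \<le> t \<Longrightarrow> 0 \<le> \<alpha> r t"
    and alpha_mono: "0 \<le> r \<Longrightarrow> 0 \<le> s \<Longrightarrow> s \<le> t \<Longrightarrow> \<alpha> r s \<le> \<alpha> r t"
    and alpha_ball: "0 \<le> r \<Longrightarrow> f \<in> Ckappa_ball \<kappa> r \<Longrightarrow> I (h n) f \<in> Ckappa_ball \<kappa> (\<alpha> r (h n))"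
    and alpha_comp: "0 \<le> r \<Longrightarrow> 1 \<le> k \<Longrightarrow> 1 \<le> l \<Longrightarrow>
      \<alpha> (\<alpha> r (real k * h n)) (real l * h n) \<le> \<alpha> r (real (k + l) * h n)"
    and omega_nonneg: "0 \<le> r \<Longrightarrow> 0 \<le> \<omega> r"
    and omega_mono: "0 \<le> r \<Longrightarrow> r \<le> s \<Longrightarrow> \<omega> r \<le> \<omega> s"
    and omega_lip: "0 \<le> r \<Longrightarrow> f \<in> Ckappa_ball \<kappa> r \<Longrightarrow> g \<in> Ckappa_ball \<kappa> r \<Longrightarrow>
      kappa_norm \<kappa> (\<lambda>x. I (h n) f x - I (h n) g x)
        \<le> exp (h n * \<omega> r) * kappa_norm \<kappa> (\<lambda>x. f x - g x)"
    and I_id: "f \<in> Ckappa \<kappa> \<Longrightarrow> I 0 f = f"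
    and D_Lipschitz: "\<D> \<subseteq> Lipschitz_set \<kappa> I"
    and D_dense: "f \<in> Ckappa \<kappa> \<Longrightarrow>
      \<exists>F. (\<forall>n. F n \<in> \<D>) \<and> (\<forall>n. kappa_norm \<kappa> (F n) \<le> kappa_norm \<kappa> f) \<and> mixed_lim \<kappa> F f"
    and I_tight: "0 < \<epsilon> \<Longrightarrow> 0 \<le> r \<Longrightarrow> 0 \<le> T \<Longrightarrow> compact K \<Longrightarrow>
      \<exists>K' c. compact K' \<and> 0 \<le> c \<and>
        (\<forall>t\<in>{0..T}. \<forall>n. \<forall>f\<in>Ckappa_ball \<kappa> r. \<forall>g\<in>Ckappa_ball \<kappa> r.
           sup_norm_on K (\<lambda>x. iterate I (h n) t f x - iterate I (h n) t g x)
             \<le> c * sup_norm_on K' (\<lambda>x. f x - g x) + \<epsilon>)"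
begin

abbreviation J :: "nat \<Rightarrow> nat \<Rightarrow> ('a \<Rightarrow> real) \<Rightarrow> 'a \<Rightarrow> real" where
  "J n k \<equiv> I (h n) ^^ k"

lemma h_nonneg [simp]: "0 \<le> h n"
  using h_pos[of n] by simp

lemma iterate_J: "iterate I (h n) t f = J n (num_steps (h n) t) f"
  by (simp add: iterate_def)

lemma J_iterate: "J n k f = iterate I (h n) (real k * h n) f"
  by (simp add: iterate_def num_steps_mult h_pos)

lemma J_Ckappa: "f \<in> Ckappa \<kappa> \<Longrightarrow> J n k f \<in> Ckappa \<kappa>"
  using I_maps by (induction k) (auto simp: operator_family_def)

text \<open>The radius \<open>\<alpha> r t\<close> is a bound only after at least one step, since it may be smaller than
  \<open>r\<close>.\<close>

lemma J_ball_alpha: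
  assumes f: "f \<in> Ckappa_ball \<kappa> r" and k: "1 \<le> k"
  shows "J n k f \<in> Ckappa_ball \<kappa> (\<alpha> r (real k * h n))"
  using k
proof (induction k rule: dec_induct)
  case base
  show ?case
    using alpha_ball[OF ball_nonneg[OF f] f] by simp
next
  case (step k)
  have "J n (Suc k) f \<in> Ckappa_ball \<kappa> (\<alpha> (\<alpha> r (real k * h n)) (h n))"
    using alpha_ball[OF ball_nonneg step.IH, OF step.IH] by simp
  then show ?case
    using alpha_comp[OF ball_nonneg[OF f] step.hyps(1), of 1 n] by (auto intro: ball_mono)
qed

text \<open>A radius that is valid for zero steps as well.\<close>

definition radius :: "real \<Rightarrow> real \<Rightarrow> real" where
  "radius r T = max r (\<alpha> r T)"

lemma radius_ge: "r \<le> radius r T" "\<alpha> r T \<le> radius r T"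
  by (simp_all add: radius_def)

lemma radius_nonneg: "0 \<le> r \<Longrightarrow> 0 \<le> radius r T"
  by (simp add: radius_def)

lemma J_alpha:
  assumes f: "f \<in> Ckappa_ball \<kappa> r" and "1 \<le> k" "real k * h n \<le> T"
  shows "J n k f \<in> Ckappa_ball \<kappa> (\<alpha> r T)"
  using ball_mono[OF J_ball_alpha[OF f assms(2)] alpha_mono[OF ball_nonneg[OF f] _ assms(3)]]
  by simp

lemma J_radius:
  assumes f: "f \<in> Ckappa_ball \<kappa> r" and T: "real k * h n \<le> T"
  shows "J n k f \<in> Ckappa_ball \<kappa> (radius r T)"
proof (cases "k = 0")
  case True
  then show ?thesis
    using f by (simp add: ball_mono[OF _ radius_ge(1)])
next
  case False
  then show ?thesis
    using ball_mono[OF J_alpha[OF f _ T] radius_ge(2)] by simp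
qed

lemma iterate_radius:
  "f \<in> Ckappa_ball \<kappa> r \<Longrightarrow> 0 \<le> t \<Longrightarrow> iterate I (h n) t f \<in> Ckappa_ball \<kappa> (radius r t)"
  unfolding iterate_J by (intro J_radius num_steps_bounds h_pos)

lemma J_mono:
  assumes "f \<in> Ckappa \<kappa>" "g \<in> Ckappa \<kappa>" "\<And>x. f x \<le> g x"
  shows "J n k f x \<le> J n k g x"
proof -
  have "J n k f \<le> J n k g"
  proof (induction k)
    case 0
    then show ?case
      using assms(3) by (simp add: le_fun_def)
  next
    case (Suc k)
    then show ?case
      using I_mono[of n] J_Ckappa assms by (auto simp: monotone_operator_def mono_on_def)
  qed
  then show ?thesis
    by (simp add: le_fun_def)
qed

lemma J_0: "J n k (\<lambda>x. 0) = (\<lambda>x. 0)"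
  by (induction k) (simp_all add: I_0)

lemma J_convex: "convex_operator \<kappa> (J n k)"
proof (induction k)
  case 0
  then show ?case
    by (simp add: convex_operator_def)
next
  case (Suc k)
  show ?case
    unfolding convex_operator_def
  proof (intro ballI allI)
    fix f g and c :: real and x
    assume fg: "f \<in> Ckappa \<kappa>" "g \<in> Ckappa \<kappa>" and c: "c \<in> {0..1}"
    let ?l = "J n k (\<lambda>y. c * f y + (1 - c) * g y)" and ?r = "\<lambda>y. c * J n k f y + (1 - c) * J n k g y"
    have C: "?l \<in> Ckappa \<kappa>" "?r \<in> Ckappa \<kappa>"
      using fg by (auto intro: J_Ckappa Ckappa_convex_comb)
    have "?l \<le> ?r"
      using Suc fg c by (auto simp: convex_operator_def le_fun_def)
    then have "I (h n) ?l x \<le> I (h n) ?r x"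
      using I_mono[of n] C by (auto simp: monotone_operator_def mono_on_def le_fun_def)
    also have "\<dots> \<le> c * I (h n) (J n k f) x + (1 - c) * I (h n) (J n k g) x"
      using I_convex[of n] c J_Ckappa[OF fg(1)] J_Ckappa[OF fg(2)] by (simp add: convex_operator_def)
    finally show "J n (Suc k) (\<lambda>y. c * f y + (1 - c) * g y) x
        \<le> c * J n (Suc k) f x + (1 - c) * J n (Suc k) g x"
      by simp
  qed
qed

text \<open>Only the first step sees the radius \<open>r\<close>; all later ones start in the ball of radius
  \<open>\<alpha> r T\<close>.  The factor of the first step tends to \<open>1\<close> with the step size, which is why the
  limit semigroup has a Lipschitz constant that depends on \<open>\<alpha> r T\<close> alone.\<close>

lemma J_lipschitz:
  assumes f: "f \<in> Ckappa_ball \<kappa> r" and g: "g \<in> Ckappa_ball \<kappa> r"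
    and N: "\<And>x. \<bar>f x - g x\<bar> * \<kappa> x \<le> N" and k: "real (Suc k) * h n \<le> T"
  shows "\<bar>J n (Suc k) f x - J n (Suc k) g x\<bar> * \<kappa> x
    \<le> exp (h n * \<omega> r + real k * h n * \<omega> (\<alpha> r T)) * N"
proof -
  have step: "\<bar>I (h n) u x - I (h n) v x\<bar> * \<kappa> x \<le> exp (h n * \<omega> s) * M"
    if u: "u \<in> Ckappa_ball \<kappa> s" and v: "v \<in> Ckappa_ball \<kappa> s"
      and M: "\<And>x. \<bar>u x - v x\<bar> * \<kappa> x \<le> M" for u v s M x
  proof -
    have "(\<lambda>x. I (h n) u x - I (h n) v x) \<in> Ckappa \<kappa>"
      using J_Ckappa[OF ball_Ckappa[OF u], of 1 n] J_Ckappa[OF ball_Ckappa[OF v], of 1 n]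
      by (auto intro: Ckappa_diff)
    then have "\<bar>I (h n) u x - I (h n) v x\<bar> * \<kappa> x \<le> kappa_norm \<kappa> (\<lambda>x. I (h n) u x - I (h n) v x)"
      by (rule kappa_norm_upper)
    also have "\<dots> \<le> exp (h n * \<omega> s) * kappa_norm \<kappa> (\<lambda>x. u x - v x)"
      by (rule omega_lip[OF ball_nonneg[OF u] u v])
    also have "\<dots> \<le> exp (h n * \<omega> s) * M"
      by (intro mult_left_mono kappa_norm_least M) simp
    finally show ?thesis .
  qed
  have "\<forall>x. \<bar>J n (Suc k) f x - J n (Suc k) g x\<bar> * \<kappa> x
      \<le> exp (h n * \<omega> r + real k * h n * \<omega> (\<alpha> r T)) * N"
    using k
  proof (induction k)
    case 0
    then show ?case
      using step[OF f g N] by simp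
  next
    case (Suc k)
    have T: "real (Suc k) * h n \<le> T"
      using Suc.prems h_pos[of n] by (simp add: algebra_simps)
    have "\<bar>J n (Suc (Suc k)) f x - J n (Suc (Suc k)) g x\<bar> * \<kappa> x
        \<le> exp (h n * \<omega> (\<alpha> r T)) * (exp (h n * \<omega> r + real k * h n * \<omega> (\<alpha> r T)) * N)" for x
      using step[OF J_alpha[OF f _ T] J_alpha[OF g _ T], of _ x] Suc.IH[OF T] by simp
    then show ?case
      by (simp add: mult.assoc[symmetric] flip: exp_add) (simp add: algebra_simps)
  qed
  then show ?thesis ..
qed

lemma J_lipschitz_radius:
  assumes f: "f \<in> Ckappa_ball \<kappa> r" and g: "g \<in> Ckappa_ball \<kappa> r"
    and N: "\<And>x. \<bar>f x - g x\<bar> * \<kappa> x \<le> N" and T: "real k * h n \<le> T"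
  shows "\<bar>J n k f x - J n k g x\<bar> * \<kappa> x \<le> exp (T * \<omega> (radius r T)) * N"
proof -
  have r: "0 \<le> r"
    using ball_nonneg[OF f] .
  have N0: "0 \<le> N"
    using N[of x] kappa_nonneg[of x] by (meson abs_ge_zero mult_nonneg_nonneg order_trans)
  have T0: "0 \<le> T"
    using T h_nonneg[of n] by (meson mult_nonneg_nonneg of_nat_0_le_iff order_trans)
  have om: "0 \<le> \<omega> (radius r T)"
    by (intro omega_nonneg radius_nonneg r)
  show ?thesis
  proof (cases k)
    case 0
    have "1 * N \<le> exp (T * \<omega> (radius r T)) * N"
      using T0 om N0 by (intro mult_right_mono) auto
    then show ?thesis
      using 0 N[of x] by simp
  next
    case (Suc j)
    have "h n * \<omega> r \<le> h n * \<omega> (radius r T)"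
      by (intro mult_left_mono omega_mono r radius_ge) simp
    moreover have "real j * h n * \<omega> (\<alpha> r T) \<le> real j * h n * \<omega> (radius r T)"
      by (intro mult_left_mono omega_mono radius_ge alpha_nonneg r T0) simp
    moreover have "real k * h n * \<omega> (radius r T) \<le> T * \<omega> (radius r T)"
      by (intro mult_right_mono T om)
    ultimately have "h n * \<omega> r + real j * h n * \<omega> (\<alpha> r T) \<le> T * \<omega> (radius r T)"
      unfolding Suc by (simp add: algebra_simps)
    then have "exp (h n * \<omega> r + real j * h n * \<omega> (\<alpha> r T)) * N \<le> exp (T * \<omega> (radius r T)) * N"
      using N0 by (intro mult_right_mono) auto
    then show ?thesis
      using J_lipschitz[OF f g N, of j n T x] T Suc by auto
  qed
qed

text \<open>Equicontinuity of all iterates on balls for the topology of uniform convergence on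
  compact sets: the quantitative tightness estimate in the form in which limits are
  interchanged below.\<close>

lemma J_equicontinuous:
  assumes "0 < \<epsilon>" "0 \<le> r" "0 \<le> T" and K: "compact K"
  obtains K' \<delta> where "compact K'" "0 < \<delta>"
    "\<And>n k f g x. real k * h n \<le> T \<Longrightarrow> f \<in> Ckappa_ball \<kappa> r \<Longrightarrow> g \<in> Ckappa_ball \<kappa> r \<Longrightarrow>
       (\<And>y. y \<in> K' \<Longrightarrow> \<bar>f y - g y\<bar> \<le> \<delta>) \<Longrightarrow> x \<in> K \<Longrightarrow> \<bar>J n k f x - J n k g x\<bar> \<le> \<epsilon>"
proof -
  obtain K' c where K': "compact K'" and c: "0 \<le> c"
    and est: "\<And>t n f g. t \<in> {0..T} \<Longrightarrow> f \<in> Ckappa_ball \<kappa> r \<Longrightarrow> g \<in> Ckappa_ball \<kappa> r \<Longrightarrow>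
       sup_norm_on K (\<lambda>x. iterate I (h n) t f x - iterate I (h n) t g x)
         \<le> c * sup_norm_on K' (\<lambda>x. f x - g x) + \<epsilon> / 2"
    using I_tight[of "\<epsilon> / 2" r T K] assms by auto
  \<comment> \<open>\<open>c + 1\<close> instead of \<open>c\<close>, which may vanish\<close>
  define \<delta> where "\<delta> = \<epsilon> / (2 * (c + 1))"
  have \<delta>: "0 < \<delta>" "c * \<delta> \<le> \<epsilon> / 2"
    using c assms(1) by (auto simp: \<delta>_def field_simps)
  show thesis
  proof (rule that[OF K' \<delta>(1)])
    fix n k f g x
    assume k: "real k * h n \<le> T" and f: "f \<in> Ckappa_ball \<kappa> r" and g: "g \<in> Ckappa_ball \<kappa> r"
      and fg: "\<And>y. y \<in> K' \<Longrightarrow> \<bar>f y - g y\<bar> \<le> \<delta>" and x: "x \<in> K"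
    have cont: "continuous_on UNIV (\<lambda>x. J n k f x - J n k g x)"
      using f g by (intro Ckappa_cont Ckappa_diff J_Ckappa ball_Ckappa)
    have "\<bar>J n k f x - J n k g x\<bar> \<le> sup_norm_on K (\<lambda>x. J n k f x - J n k g x)"
      by (rule sup_norm_on_upper[OF K cont x])
    also have "\<dots> \<le> c * sup_norm_on K' (\<lambda>x. f x - g x) + \<epsilon> / 2"
      using est[of "real k * h n" f g n] k f g by (simp add: J_iterate)
    also have "\<dots> \<le> c * \<delta> + \<epsilon> / 2"
      using c \<delta>(1) fg by (intro add_right_mono mult_left_mono sup_norm_on_least) auto
    finally show "\<bar>J n k f x - J n k g x\<bar> \<le> \<epsilon>"
      using \<delta>(2) by simp
  qed
qed

text \<open>The iterates of \<open>f\<close> are Lipschitz in time as soon as the first increment is of the order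
  of the step size, because the increments \<open>J n i (I (h n) f) - J n i f\<close> are images of the
  first one under operators with a common Lipschitz constant.\<close>

lemma J_time_Lipschitz:
  assumes f: "f \<in> Lipschitz_set \<kappa> I" and T: "0 \<le> T"
  obtains C N where "0 \<le> C"
    "\<And>n j k x. N \<le> n \<Longrightarrow> real j * h n \<le> T \<Longrightarrow> real k * h n \<le> T \<Longrightarrow>
       \<bar>J n j f x - J n k f x\<bar> * \<kappa> x \<le> C * \<bar>real j * h n - real k * h n\<bar>"
proof -
  obtain c t0 where c: "0 \<le> c" and t0: "0 < t0"
    and est: "\<And>t. t \<in> {0..t0} \<Longrightarrow> kappa_norm \<kappa> (\<lambda>x. I t f x - f x) \<le> c * t"
    and fC: "f \<in> Ckappa \<kappa>"
    using f by (auto simp: Lipschitz_set_def)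
  have "\<forall>\<^sub>F n in sequentially. h n < t0"
    using h_lim t0 by (rule order_tendstoD)
  then obtain N where N: "\<And>n. N \<le> n \<Longrightarrow> h n < t0"
    by (auto simp: eventually_sequentially)
  define r where "r = kappa_norm \<kappa> f + c * t0"
  define C where "C = exp (T * \<omega> (radius r T)) * c"
  have fr: "f \<in> Ckappa_ball \<kappa> r"
    using c t0 by (intro ball_mono[OF Ckappa_in_ball[OF fC]]) (simp add: r_def)
  have inc: "\<bar>J n (Suc i) f x - J n i f x\<bar> * \<kappa> x \<le> C * h n"
    if n: "N \<le> n" and i: "real i * h n \<le> T" for n i x
  proof -
    have IC: "I (h n) f \<in> Ckappa \<kappa>"
      using J_Ckappa[OF fC, of 1 n] by simp
    have d: "kappa_norm \<kappa> (\<lambda>x. I (h n) f x - f x) \<le> c * h n"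
      using est[of "h n"] N[OF n] by simp
    have d': "\<bar>I (h n) f x - f x\<bar> * \<kappa> x \<le> c * h n" for x
      using kappa_norm_upper[OF Ckappa_diff[OF IC fC], of x] d by simp
    have "(\<lambda>x. (I (h n) f x - f x) + f x) \<in> Ckappa_ball \<kappa> (c * h n + kappa_norm \<kappa> f)"
      using d Ckappa_diff[OF IC fC] by (intro ball_add Ckappa_in_ball fC) (simp add: Ckappa_ball_def)
    moreover have "c * h n \<le> c * t0"
      using N[OF n] c by (intro mult_left_mono) auto
    ultimately have "I (h n) f \<in> Ckappa_ball \<kappa> r"
      by (auto simp: r_def intro: ball_mono)
    from J_lipschitz_radius[OF this fr d' i, of x] show ?thesis
      by (simp add: C_def funpow_swap1 mult.assoc)
  qed
  have le: "\<bar>J n k f x - J n j f x\<bar> * \<kappa> x \<le> C * (real k * h n - real j * h n)"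
    if n: "N \<le> n" and "j \<le> k" and "real k * h n \<le> T" for n j k x
    using that(2,3)
  proof (induction k rule: dec_induct)
    case base
    then show ?case by simp
  next
    case (step k)
    have k: "real k * h n \<le> T"
      using step.prems h_pos[of n] by (simp add: algebra_simps)
    have "\<bar>J n (Suc k) f x - J n j f x\<bar> * \<kappa> x
        \<le> (\<bar>J n (Suc k) f x - J n k f x\<bar> + \<bar>J n k f x - J n j f x\<bar>) * \<kappa> x"
      by (intro mult_right_mono) auto
    also have "\<dots> \<le> C * h n + C * (real k * h n - real j * h n)"
      using inc[OF n k, of x] step.IH[OF k] by (simp add: distrib_right)
    finally show ?case
      by (simp add: algebra_simps)
  qed
  show thesis
  proof (rule that[of C N])
    show "0 \<le> C"
      using c by (simp add: C_def)
    fix n j k x assume n: "N \<le> n" and jk: "real j * h n \<le> T" "real k * h n \<le> T"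
    show "\<bar>J n j f x - J n k f x\<bar> * \<kappa> x \<le> C * \<bar>real j * h n - real k * h n\<bar>"
    proof (cases "j \<le> k")
      case True
      then have "real j * h n \<le> real k * h n"
        by (simp add: mult_right_mono)
      then show ?thesis
        using le[OF n True jk(2), of x] by (simp add: abs_minus_commute)
    next
      case False
      then have "real k * h n \<le> real j * h n"
        by (simp add: mult_right_mono)
      then show ?thesis
        using le[OF n _ jk(1), of k x] False by simp
    qed
  qed
qed

text \<open>Rounding \<open>s\<close> and \<open>t\<close> down to the time grid costs at most one step.\<close>

lemma iterate_time_Lipschitz:
  assumes f: "f \<in> Lipschitz_set \<kappa> I" and T: "0 \<le> T"
  obtains C N where "0 \<le> C"
    "\<And>n s t x. N \<le> n \<Longrightarrow> s \<in> {0..T} \<Longrightarrow> t \<in> {0..T} \<Longrightarrow>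
       \<bar>iterate I (h n) s f x - iterate I (h n) t f x\<bar> * \<kappa> x \<le> C * (\<bar>s - t\<bar> + h n)"
proof -
  obtain C N where C: "0 \<le> C"
    and est: "\<And>n j k x. N \<le> n \<Longrightarrow> real j * h n \<le> T \<Longrightarrow> real k * h n \<le> T \<Longrightarrow>
       \<bar>J n j f x - J n k f x\<bar> * \<kappa> x \<le> C * \<bar>real j * h n - real k * h n\<bar>"
    using J_time_Lipschitz[OF f T] by metis
  show thesis
  proof (rule that[OF C])
    fix n s t x assume n: "N \<le> n" and st: "s \<in> {0..T}" "t \<in> {0..T}"
    let ?j = "num_steps (h n) s" and ?k = "num_steps (h n) t"
    note s = num_steps_bounds[OF h_pos[of n], of s] and t = num_steps_bounds[OF h_pos[of n], of t]
    have "\<bar>real ?j * h n - real ?k * h n\<bar> \<le> \<bar>s - t\<bar> + h n"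
      using s t st by auto
    then have "C * \<bar>real ?j * h n - real ?k * h n\<bar> \<le> C * (\<bar>s - t\<bar> + h n)"
      using C by (rule mult_left_mono)
    then show "\<bar>iterate I (h n) s f x - iterate I (h n) t f x\<bar> * \<kappa> x \<le> C * (\<bar>s - t\<bar> + h n)"
      using est[OF n, of ?j ?k x] s(1) t(1) st by (simp add: iterate_J)
  qed
qed

lemma approximate_in_D:
  assumes f: "f \<in> Ckappa \<kappa>" and K: "compact K" and "0 < \<delta>"
  obtains g where "g \<in> \<D>" "g \<in> Ckappa_ball \<kappa> (kappa_norm \<kappa> f)" "\<And>x. x \<in> K \<Longrightarrow> \<bar>g x - f x\<bar> \<le> \<delta>"
proof -
  obtain F where F: "\<And>n. F n \<in> \<D>" "\<And>n. kappa_norm \<kappa> (F n) \<le> kappa_norm \<kappa> f" "mixed_lim \<kappa> F f"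
    using D_dense[OF f] by blast
  have "\<forall>\<^sub>F n in sequentially. \<forall>x\<in>K. dist (F n x) (f x) < \<delta>"
    by (rule uniform_limitD[OF mixed_lim_uniform[OF F(3) K] assms(3)])
  then obtain n where "\<forall>x\<in>K. dist (F n x) (f x) < \<delta>"
    by (auto simp: eventually_sequentially)
  then show thesis
    using that[of "F n"] F mixed_lim_Ckappa(2)[OF F(3)]
    by (auto simp: Ckappa_ball_def dist_real_def less_imp_le)
qed

text \<open>Strong continuity at time \<open>0\<close>, uniformly in \<open>n\<close>: a function of \<open>\<D>\<close> close to \<open>f\<close> on a large compact
  set moves slowly, and its iterates stay close to those of \<open>f\<close>.\<close>

lemma J_small_time:
  assumes f: "f \<in> Ckappa \<kappa>" and K: "compact K" and \<epsilon>: "0 < \<epsilon>"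
  obtains \<delta> N where "0 < \<delta>"
    "\<And>n k x. N \<le> n \<Longrightarrow> real k * h n \<le> \<delta> \<Longrightarrow> x \<in> K \<Longrightarrow> \<bar>J n k f x - f x\<bar> \<le> \<epsilon>"
proof -
  let ?r = "kappa_norm \<kappa> f"
  obtain K' \<eta> where K': "compact K'" "0 < \<eta>"
    and eq: "\<And>n k u v x. real k * h n \<le> 1 \<Longrightarrow> u \<in> Ckappa_ball \<kappa> ?r \<Longrightarrow> v \<in> Ckappa_ball \<kappa> ?r \<Longrightarrow>
       (\<And>y. y \<in> K' \<Longrightarrow> \<bar>u y - v y\<bar> \<le> \<eta>) \<Longrightarrow> x \<in> K \<Longrightarrow> \<bar>J n k u x - J n k v x\<bar> \<le> \<epsilon> / 3"
    using J_equicontinuous[of "\<epsilon> / 3" ?r 1 K] \<epsilon> K kappa_norm_nonneg[OF f] by auto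
  obtain g where g: "g \<in> \<D>" "g \<in> Ckappa_ball \<kappa> ?r"
    and gf: "\<And>x. x \<in> K \<union> K' \<Longrightarrow> \<bar>g x - f x\<bar> \<le> min \<eta> (\<epsilon> / 3)"
    using approximate_in_D[OF f compact_Un[OF K K'(1)], of "min \<eta> (\<epsilon> / 3)"] K'(2) \<epsilon> by auto
  obtain C N where C: "0 \<le> C"
    and est: "\<And>n j k x. N \<le> n \<Longrightarrow> real j * h n \<le> 1 \<Longrightarrow> real k * h n \<le> 1 \<Longrightarrow>
       \<bar>J n j g x - J n k g x\<bar> * \<kappa> x \<le> C * \<bar>real j * h n - real k * h n\<bar>"
    using J_time_Lipschitz[of g 1] g(1) D_Lipschitz by (metis subsetD zero_le_one)
  obtain a where a: "0 < a" "\<And>x. x \<in> K \<Longrightarrow> a \<le> \<kappa> x"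
    using compact_kappa_lower[OF K] by blast
  define \<delta> where "\<delta> = min 1 (a * \<epsilon> / (3 * (C + 1)))"
  have \<delta>: "0 < \<delta>" "\<delta> \<le> 1"
    using a C \<epsilon> by (auto simp: \<delta>_def)
  have "C * \<delta> \<le> (C + 1) * (a * \<epsilon> / (3 * (C + 1)))"
    using C \<delta> by (intro mult_mono) (auto simp: \<delta>_def)
  also have "\<dots> = a * \<epsilon> / 3"
    using C by (simp add: field_simps)
  finally have C\<delta>: "C * \<delta> \<le> a * \<epsilon> / 3" .
  show thesis
  proof (rule that[OF \<delta>(1)])
    fix n k x assume n: "N \<le> n" and k: "real k * h n \<le> \<delta>" and x: "x \<in> K"
    have k1: "real k * h n \<le> 1"
      using k \<delta> by simp
    have "\<bar>J n k g x - g x\<bar> * a \<le> \<bar>J n k g x - g x\<bar> * \<kappa> x"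
      using a(2)[OF x] by (intro mult_left_mono) auto
    also have "\<dots> \<le> C * (real k * h n)"
      using est[OF n k1, of 0 x] by simp
    also have "\<dots> \<le> C * \<delta>"
      using k C by (intro mult_left_mono)
    finally have "\<bar>J n k g x - g x\<bar> * a \<le> \<epsilon> / 3 * a"
      using C\<delta> by (simp add: mult.commute)
    then have "\<bar>J n k g x - g x\<bar> \<le> \<epsilon> / 3"
      using a(1) by simp
    moreover have "\<bar>J n k g x - J n k f x\<bar> \<le> \<epsilon> / 3"
      using gf by (intro eq k1 g(2) Ckappa_in_ball f x) auto
    moreover have "\<bar>g x - f x\<bar> \<le> \<epsilon> / 3"
      using gf[of x] x by simp
    ultimately show "\<bar>J n k f x - f x\<bar> \<le> \<epsilon>"
      by linarith
  qed
qed

section \<open>A convergent subsequence\<close>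

text \<open>The iterates are scaled by \<open>\<kappa> q / R f t\<close> to make the family bounded by \<open>1\<close>, so that the
  diagonal argument applies; the factor is constant along the sequence and can be removed
  afterwards.\<close>

lemma pointwise_convergent_subsequence:
  assumes "countable \<D>" "countable \<T>" "\<T> \<subseteq> {0..}" "countable Q"
  obtains \<sigma> :: "nat \<Rightarrow> nat" where "strict_mono \<sigma>"
    "\<And>f t q. f \<in> \<D> \<Longrightarrow> t \<in> \<T> \<Longrightarrow> q \<in> Q \<Longrightarrow> convergent (\<lambda>l. iterate I (h (\<sigma> l)) t f q)"
proof -
  define R where "R f t = radius (kappa_norm \<kappa> f) t + 1" for f t
  define \<phi> where "\<phi> n = (\<lambda>(f, t, q). iterate I (h n) t f q * (\<kappa> q / R f t))" for n
  have D: "f \<in> Ckappa \<kappa>" if "f \<in> \<D>" for f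
    using that D_Lipschitz by (auto simp: Lipschitz_set_def)
  have R: "0 < R f t" if "f \<in> \<D>" for f t
    using radius_nonneg[OF kappa_norm_nonneg[OF D[OF that]], of t] by (simp add: R_def)
  have "norm (\<phi> n z) \<le> 1" if "z \<in> \<D> \<times> \<T> \<times> Q" for n z
  proof -
    obtain f t q where z: "z = (f, t, q)" "f \<in> \<D>" "t \<in> \<T>"
      using \<open>z \<in> \<D> \<times> \<T> \<times> Q\<close> by (elim SigmaE) blast
    have "iterate I (h n) t f \<in> Ckappa_ball \<kappa> (radius (kappa_norm \<kappa> f) t)"
      using z(3) assms(3) by (intro iterate_radius Ckappa_in_ball D z(2)) auto
    from ball_bound[OF this, of q] have "\<bar>iterate I (h n) t f q\<bar> * \<kappa> q \<le> R f t"
      by (simp add: R_def)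
    then show ?thesis
      using R[OF z(2), of t] by (simp add: z \<phi>_def abs_mult field_simps)
  qed
  moreover have "countable (\<D> \<times> \<T> \<times> Q)"
    using assms by auto
  ultimately obtain \<sigma> :: "nat \<Rightarrow> nat" where \<sigma>: "strict_mono \<sigma>"
    and conv: "\<And>z. z \<in> \<D> \<times> \<T> \<times> Q \<Longrightarrow> \<exists>l. (\<lambda>n. \<phi> (\<sigma> n) z) \<longlonglongrightarrow> l"
    using function_convergent_subsequence[of "\<D> \<times> \<T> \<times> Q" \<phi> 1] by blast
  show thesis
  proof (rule that[OF \<sigma>])
    fix f t q assume "f \<in> \<D>" "t \<in> \<T>" "q \<in> Q"
    then obtain l where "(\<lambda>n. iterate I (h (\<sigma> n)) t f q * (\<kappa> q / R f t)) \<longlonglongrightarrow> l"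
      using conv[of "(f, t, q)"] by (auto simp: \<phi>_def)
    then have "(\<lambda>n. iterate I (h (\<sigma> n)) t f q * (\<kappa> q / R f t) * (R f t / \<kappa> q)) \<longlonglongrightarrow> l * (R f t / \<kappa> q)"
      by (rule tendsto_mult_right)
    then show "convergent (\<lambda>l. iterate I (h (\<sigma> l)) t f q)"
      using kappa_pos[of q] R[OF \<open>f \<in> \<D>\<close>, of t] by (auto simp: convergent_def)
  qed
qed

text \<open>The time Lipschitz estimate turns convergence at the times of \<open>\<T>\<close> into
  convergence at every \<open>t \<ge> 0\<close>: the iterates at \<open>t\<close> differ from those at a nearby \<open>s \<in> \<T>\<close> by
  a multiple of \<open>\<bar>t - s\<bar> + h n\<close>.\<close>

lemma iterates_Cauchy_all_times:
  assumes \<sigma>: "strict_mono \<sigma>" and f: "f \<in> Lipschitz_set \<kappa> I" and K: "compact K"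
    and T: "\<T> \<subseteq> {0..}" "{0..} \<subseteq> closure \<T>"
    and cauchy: "\<And>t. t \<in> \<T> \<Longrightarrow> uniformly_Cauchy_on K (\<lambda>l. iterate I (h (\<sigma> l)) t f)"
    and t: "0 \<le> t"
  shows "uniformly_Cauchy_on K (\<lambda>l. iterate I (h (\<sigma> l)) t f)"
proof (rule uniformly_Cauchy_on_approx)
  fix \<epsilon> :: real assume \<epsilon>: "0 < \<epsilon>"
  have "0 \<le> t + 1"
    using t by simp
  then obtain C N where C: "0 \<le> C"
    and est: "\<And>n s s' x. N \<le> n \<Longrightarrow> s \<in> {0..t + 1} \<Longrightarrow> s' \<in> {0..t + 1} \<Longrightarrow>
       \<bar>iterate I (h n) s f x - iterate I (h n) s' f x\<bar> * \<kappa> x \<le> C * (\<bar>s - s'\<bar> + h n)"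
    using iterate_time_Lipschitz[OF f] by metis
  obtain a where a: "0 < a" "\<And>x. x \<in> K \<Longrightarrow> a \<le> \<kappa> x"
    using compact_kappa_lower[OF K] by blast
  define \<delta> where "\<delta> = min 1 (a * \<epsilon> / (2 * (C + 1)))"
  have \<delta>: "0 < \<delta>" "\<delta> \<le> 1"
    using a C \<epsilon> by (auto simp: \<delta>_def)
  have "C * (\<delta> + \<delta>) \<le> (C + 1) * (2 * (a * \<epsilon> / (2 * (C + 1))))"
    using C \<delta> by (intro mult_mono) (auto simp: \<delta>_def)
  also have "\<dots> = \<epsilon> * a"
    using C by (simp add: field_simps)
  finally have C\<delta>: "C * (\<delta> + \<delta>) \<le> \<epsilon> * a" .
  obtain s where s: "s \<in> \<T>" "dist s t < \<delta>"
    using T(2) t \<delta>(1) by (meson atLeast_iff closure_approachable subsetD)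
  have s0: "s \<in> {0..t + 1}"
    using s T(1) \<delta>(2) by (auto simp: dist_real_def)
  have "\<forall>\<^sub>F n in sequentially. h n < \<delta>"
    using h_lim \<delta>(1) by (rule order_tendstoD)
  then obtain M where M: "\<And>n. M \<le> n \<Longrightarrow> h n < \<delta>"
    by (auto simp: eventually_sequentially)
  have "dist (iterate I (h (\<sigma> l)) t f x) (iterate I (h (\<sigma> l)) s f x) \<le> \<epsilon>"
    if l: "max M N \<le> l" and x: "x \<in> K" for l x
  proof -
    have l': "M \<le> \<sigma> l" "N \<le> \<sigma> l"
      using l seq_suble[OF \<sigma>, of l] by auto
    let ?d = "\<bar>iterate I (h (\<sigma> l)) t f x - iterate I (h (\<sigma> l)) s f x\<bar>"
    have "?d * a \<le> ?d * \<kappa> x"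
      using a(2)[OF x] by (intro mult_left_mono) auto
    also have "\<dots> \<le> C * (\<bar>t - s\<bar> + h (\<sigma> l))"
      using t s0 by (intro est l') auto
    also have "\<dots> \<le> C * (\<delta> + \<delta>)"
      using C s(2) M[OF l'(1)] by (intro mult_left_mono) (auto simp: dist_real_def)
    finally have "?d * a \<le> \<epsilon> * a"
      using C\<delta> by simp
    then show ?thesis
      using a(1) by (simp add: dist_real_def)
  qed
  then show "\<exists>v N. uniformly_Cauchy_on K v \<and>
      (\<forall>n\<ge>N. \<forall>x\<in>K. dist (iterate I (h (\<sigma> n)) t f x) (v n x) \<le> \<epsilon>)"
    using cauchy[OF s(1)] by blast
qed

text \<open>By tightness, the iterates of \<open>f\<close> are uniformly close on \<open>K\<close> to those of a function in \<open>\<D>\<close> that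
  is close to \<open>f\<close> on a larger compact set.\<close>

lemma iterates_Cauchy_all_functions:
  assumes f: "f \<in> Ckappa \<kappa>" and t: "0 \<le> t" and K: "compact K"
    and cauchy: "\<And>g. g \<in> \<D> \<Longrightarrow> uniformly_Cauchy_on K (\<lambda>l. iterate I (h (\<sigma> l)) t g)"
  shows "uniformly_Cauchy_on K (\<lambda>l. iterate I (h (\<sigma> l)) t f)"
proof (rule uniformly_Cauchy_on_approx)
  fix \<epsilon> :: real assume \<epsilon>: "0 < \<epsilon>"
  let ?r = "kappa_norm \<kappa> f"
  obtain K' \<eta> where K': "compact K'" "0 < \<eta>"
    and eq: "\<And>n k u v x. real k * h n \<le> t \<Longrightarrow> u \<in> Ckappa_ball \<kappa> ?r \<Longrightarrow> v \<in> Ckappa_ball \<kappa> ?r \<Longrightarrow>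
       (\<And>y. y \<in> K' \<Longrightarrow> \<bar>u y - v y\<bar> \<le> \<eta>) \<Longrightarrow> x \<in> K \<Longrightarrow> \<bar>J n k u x - J n k v x\<bar> \<le> \<epsilon>"
    using J_equicontinuous[of \<epsilon> ?r t K] \<epsilon> t K kappa_norm_nonneg[OF f] by auto
  obtain g where g: "g \<in> \<D>" "g \<in> Ckappa_ball \<kappa> ?r" "\<And>x. x \<in> K' \<Longrightarrow> \<bar>g x - f x\<bar> \<le> \<eta>"
    using approximate_in_D[OF f K'] by blast
  have "dist (iterate I (h (\<sigma> l)) t f x) (iterate I (h (\<sigma> l)) t g x) \<le> \<epsilon>" if x: "x \<in> K" for l x
    unfolding dist_real_def iterate_J
    using g(3) num_steps_bounds(1)[OF h_pos t]
    by (intro eq Ckappa_in_ball f g(2) x) (auto simp: abs_minus_commute)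
  then show "\<exists>v N. uniformly_Cauchy_on K v \<and>
      (\<forall>n\<ge>N. \<forall>x\<in>K. dist (iterate I (h (\<sigma> n)) t f x) (v n x) \<le> \<epsilon>)"
    using cauchy[OF g(1)] by blast
qed

lemma mixed_lim_if_Cauchy:
  assumes f: "f \<in> Ckappa \<kappa>" and t: "0 \<le> t"
    and cauchy: "\<And>K. compact K \<Longrightarrow> uniformly_Cauchy_on K (\<lambda>l. iterate I (h (\<sigma> l)) t f)"
  shows "mixed_lim \<kappa> (\<lambda>l. iterate I (h (\<sigma> l)) t f) (\<lambda>x. lim (\<lambda>l. iterate I (h (\<sigma> l)) t f x))"
  by (rule mixed_limI(1)[OF iterate_radius[OF Ckappa_in_ball[OF f] t]])
    (use Cauchy_uniformly_convergent[OF cauchy] in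
      \<open>simp add: uniformly_convergent_uniform_limit_iff\<close>)

end

section \<open>The limit semigroup\<close>

text \<open>Convergence is assumed at all times and not only at those of a dense set, so the properties of
  \<open>S t\<close> pass to the limit in one stroke.\<close>

locale iteration_limit = iteration_scheme +
  fixes S :: "real \<Rightarrow> ('a \<Rightarrow> real) \<Rightarrow> 'a \<Rightarrow> real"
  assumes S_lim: "f \<in> Ckappa \<kappa> \<Longrightarrow> 0 \<le> t \<Longrightarrow> mixed_lim \<kappa> (\<lambda>n. iterate I (h n) t f) (S t f)"
begin

lemma S_Ckappa: "f \<in> Ckappa \<kappa> \<Longrightarrow> 0 \<le> t \<Longrightarrow> S t f \<in> Ckappa \<kappa>"
  using S_lim mixed_lim_Ckappa by blast

lemma S_tendsto: "f \<in> Ckappa \<kappa> \<Longrightarrow> 0 \<le> t \<Longrightarrow> (\<lambda>n. iterate I (h n) t f x) \<longlonglongrightarrow> S t f x"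
  using S_lim mixed_lim_tendsto by blast

lemma S_radius: "f \<in> Ckappa_ball \<kappa> r \<Longrightarrow> 0 \<le> t \<Longrightarrow> S t f \<in> Ckappa_ball \<kappa> (radius r t)"
  by (rule mixed_lim_ball[OF S_lim iterate_radius]) (auto intro: ball_Ckappa)

lemma radius_mono: "0 \<le> r \<Longrightarrow> 0 \<le> s \<Longrightarrow> s \<le> t \<Longrightarrow> radius r s \<le> radius r t"
  unfolding radius_def using alpha_mono[of r s t] by linarith

lemma eventually_Suc_steps:
  assumes "0 < t"
  shows "\<forall>\<^sub>F n in sequentially. \<exists>k. num_steps (h n) t = Suc k"
proof -
  have "\<forall>\<^sub>F n in sequentially. h n < t"
    using h_lim assms by (rule order_tendstoD)
  then show ?thesis
  proof eventually_elim
    case (elim n)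
    then have "num_steps (h n) t \<noteq> 0"
      using num_steps_bounds(2)[OF h_pos[of n], of t] assms by (intro notI) simp
    then show ?case
      by (simp add: not0_implies_Suc)
  qed
qed

lemma S_alpha:
  assumes f: "f \<in> Ckappa_ball \<kappa> r" and t: "0 < t"
  shows "kappa_norm \<kappa> (S t f) \<le> \<alpha> r t"
proof (rule kappa_norm_least)
  fix x
  have t0: "0 \<le> t"
    using t by simp
  have "(\<lambda>n. \<bar>iterate I (h n) t f x\<bar> * \<kappa> x) \<longlonglongrightarrow> \<bar>S t f x\<bar> * \<kappa> x"
    by (intro tendsto_intros S_tendsto[OF ball_Ckappa[OF f] t0])
  moreover have "\<forall>\<^sub>F n in sequentially. \<bar>iterate I (h n) t f x\<bar> * \<kappa> x \<le> \<alpha> r t"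
    using eventually_Suc_steps[OF t]
  proof eventually_elim
    case (elim n)
    then show ?case
      unfolding iterate_J using num_steps_bounds(1)[OF h_pos t0, of n]
      by (intro ball_bound J_alpha[OF f]) auto
  qed
  ultimately show "\<bar>S t f x\<bar> * \<kappa> x \<le> \<alpha> r t"
    by (rule tendsto_upperbound) simp
qed

lemma S_0:
  assumes f: "f \<in> Ckappa \<kappa>"
  shows "S 0 f = f"
proof
  fix x
  have "(\<lambda>n. iterate I (h n) 0 f x) \<longlonglongrightarrow> S 0 f x"
    using S_tendsto[OF f] by simp
  then show "S 0 f x = f x"
    by (simp add: iterate_J num_steps_0 h_pos LIMSEQ_const_iff)
qed

lemma S_zero:
  assumes "0 \<le> t"
  shows "S t (\<lambda>x. 0) = (\<lambda>x. 0)"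
proof
  fix x
  show "S t (\<lambda>x. 0) x = 0"
    using S_tendsto[OF zero_in_Ckappa assms, of x] by (simp add: iterate_J J_0 LIMSEQ_const_iff)
qed

lemma S_mono:
  assumes fg: "f \<in> Ckappa \<kappa>" "g \<in> Ckappa \<kappa>" "\<And>x. f x \<le> g x" and t: "0 \<le> t"
  shows "S t f x \<le> S t g x"
  by (rule LIMSEQ_le[OF S_tendsto[OF fg(1) t] S_tendsto[OF fg(2) t]])
    (auto simp: iterate_J intro!: J_mono fg)

lemma S_convex:
  assumes t: "0 \<le> t"
  shows "convex_operator \<kappa> (S t)"
  unfolding convex_operator_def
proof (intro ballI allI)
  fix f g and c :: real and x
  assume fg: "f \<in> Ckappa \<kappa>" "g \<in> Ckappa \<kappa>" and c: "c \<in> {0..1}"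
  have "(\<lambda>n. c * iterate I (h n) t f x + (1 - c) * iterate I (h n) t g x)
      \<longlonglongrightarrow> c * S t f x + (1 - c) * S t g x"
    by (intro tendsto_intros S_tendsto fg t)
  then show "S t (\<lambda>y. c * f y + (1 - c) * g y) x \<le> c * S t f x + (1 - c) * S t g x"
  proof (rule LIMSEQ_le[OF S_tendsto[OF Ckappa_convex_comb[OF fg] t]], intro exI allI impI)
    fix n
    show "iterate I (h n) t (\<lambda>y. c * f y + (1 - c) * g y) x
        \<le> c * iterate I (h n) t f x + (1 - c) * iterate I (h n) t g x"
      unfolding iterate_J using J_convex[of "num_steps (h n) t" n] fg c
      by (simp add: convex_operator_def)
  qed
qed

lemma S_lipschitz:
  assumes f: "f \<in> Ckappa_ball \<kappa> r" and g: "g \<in> Ckappa_ball \<kappa> r"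
    and N: "\<And>x. \<bar>f x - g x\<bar> * \<kappa> x \<le> N" and t: "0 \<le> t"
  shows "\<bar>S t f x - S t g x\<bar> * \<kappa> x \<le> exp (t * \<omega> (\<alpha> r t)) * N"
proof (cases "t = 0")
  case True
  then show ?thesis
    using N S_0 f g ball_Ckappa by simp
next
  case False
  have r: "0 \<le> r"
    by (rule ball_nonneg[OF f])
  have N0: "0 \<le> N"
    using N[of x] kappa_nonneg[of x] by (meson abs_ge_zero mult_nonneg_nonneg order_trans)
  have "(\<lambda>n. exp (h n * \<omega> r + t * \<omega> (\<alpha> r t)) * N) \<longlonglongrightarrow> exp (0 * \<omega> r + t * \<omega> (\<alpha> r t)) * N"
    by (intro tendsto_intros h_lim)
  then have lim: "(\<lambda>n. exp (h n * \<omega> r + t * \<omega> (\<alpha> r t)) * N) \<longlonglongrightarrow> exp (t * \<omega> (\<alpha> r t)) * N"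
    by simp
  show ?thesis
  proof (rule weighted_diff_le_tendsto[OF S_tendsto[OF ball_Ckappa[OF f] t]
        S_tendsto[OF ball_Ckappa[OF g] t] lim])
    fix x
    have "\<forall>\<^sub>F n in sequentially. \<exists>k. num_steps (h n) t = Suc k"
      using False t by (intro eventually_Suc_steps) simp
    then show "\<forall>\<^sub>F n in sequentially. \<bar>iterate I (h n) t f x - iterate I (h n) t g x\<bar> * \<kappa> x
        \<le> exp (h n * \<omega> r + t * \<omega> (\<alpha> r t)) * N"
    proof eventually_elim
      case (elim n)
      then obtain k where k: "num_steps (h n) t = Suc k"
        by blast
      then have T: "real (Suc k) * h n \<le> t"
        using num_steps_bounds(1)[OF h_pos t, of n] by simp
      then have "real k * h n \<le> t"
        using h_pos[of n] by (simp add: algebra_simps)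
      then have "real k * h n * \<omega> (\<alpha> r t) \<le> t * \<omega> (\<alpha> r t)"
        by (intro mult_right_mono omega_nonneg alpha_nonneg r t)
      then have "exp (h n * \<omega> r + real k * h n * \<omega> (\<alpha> r t)) * N
          \<le> exp (h n * \<omega> r + t * \<omega> (\<alpha> r t)) * N"
        using N0 by (intro mult_right_mono) auto
      with J_lipschitz[OF f g N T, of x] show ?case
        unfolding iterate_J k by linarith
    qed
  qed
qed

lemma S_tight:
  assumes "0 < \<epsilon>" "0 \<le> r" "0 \<le> T" and K: "compact K"
  shows "\<exists>K' c. compact K' \<and> 0 \<le> c \<and>
    (\<forall>t\<in>{0..T}. \<forall>f\<in>Ckappa_ball \<kappa> r. \<forall>g\<in>Ckappa_ball \<kappa> r.
       sup_norm_on K (\<lambda>x. S t f x - S t g x) \<le> c * sup_norm_on K' (\<lambda>x. f x - g x) + \<epsilon>)"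
proof -
  obtain K' c where K': "compact K'" and c: "0 \<le> c"
    and est: "\<And>t n f g. t \<in> {0..T} \<Longrightarrow> f \<in> Ckappa_ball \<kappa> r \<Longrightarrow> g \<in> Ckappa_ball \<kappa> r \<Longrightarrow>
       sup_norm_on K (\<lambda>x. iterate I (h n) t f x - iterate I (h n) t g x)
         \<le> c * sup_norm_on K' (\<lambda>x. f x - g x) + \<epsilon>"
    using I_tight[OF assms] by auto
  have "sup_norm_on K (\<lambda>x. S t f x - S t g x) \<le> c * sup_norm_on K' (\<lambda>x. f x - g x) + \<epsilon>"
    if t: "t \<in> {0..T}" and f: "f \<in> Ckappa_ball \<kappa> r" and g: "g \<in> Ckappa_ball \<kappa> r" for t f g
  proof (rule sup_norm_on_least)
    note fC = ball_Ckappa[OF f] and gC = ball_Ckappa[OF g]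
    have "0 \<le> c * sup_norm_on K' (\<lambda>x. f x - g x)"
      by (intro mult_nonneg_nonneg c sup_norm_on_nonneg K' Ckappa_cont Ckappa_diff fC gC)
    then show "0 \<le> c * sup_norm_on K' (\<lambda>x. f x - g x) + \<epsilon>"
      using assms(1) by simp
    fix x assume x: "x \<in> K"
    have "\<bar>iterate I (h n) t f x - iterate I (h n) t g x\<bar> \<le> c * sup_norm_on K' (\<lambda>x. f x - g x) + \<epsilon>" for n
    proof -
      have "\<bar>iterate I (h n) t f x - iterate I (h n) t g x\<bar>
          \<le> sup_norm_on K (\<lambda>x. iterate I (h n) t f x - iterate I (h n) t g x)"
        unfolding iterate_J
        by (rule sup_norm_on_upper[OF K _ x]) (intro Ckappa_cont Ckappa_diff J_Ckappa fC gC)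
      then show ?thesis
        using est[OF t f g, of n] by linarith
    qed
    moreover have "(\<lambda>n. \<bar>iterate I (h n) t f x - iterate I (h n) t g x\<bar>) \<longlonglongrightarrow> \<bar>S t f x - S t g x\<bar>"
      using t by (intro tendsto_intros S_tendsto fC gC) auto
    ultimately show "\<bar>S t f x - S t g x\<bar> \<le> c * sup_norm_on K' (\<lambda>x. f x - g x) + \<epsilon>"
      by (blast intro: LIMSEQ_le_const2)
  qed
  then show ?thesis
    using K' c by blast
qed

lemma S_equicontinuous:
  assumes "0 < \<epsilon>" "0 \<le> r" "0 \<le> T" and K: "compact K"
  obtains K' \<delta> where "compact K'" "0 < \<delta>"
    "\<And>t f g x. t \<in> {0..T} \<Longrightarrow> f \<in> Ckappa_ball \<kappa> r \<Longrightarrow> g \<in> Ckappa_ball \<kappa> r \<Longrightarrow>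
       (\<And>y. y \<in> K' \<Longrightarrow> \<bar>f y - g y\<bar> \<le> \<delta>) \<Longrightarrow> x \<in> K \<Longrightarrow> \<bar>S t f x - S t g x\<bar> \<le> \<epsilon>"
proof -
  obtain K' \<delta> where K': "compact K'" "0 < \<delta>"
    and eq: "\<And>n k f g x. real k * h n \<le> T \<Longrightarrow> f \<in> Ckappa_ball \<kappa> r \<Longrightarrow> g \<in> Ckappa_ball \<kappa> r \<Longrightarrow>
       (\<And>y. y \<in> K' \<Longrightarrow> \<bar>f y - g y\<bar> \<le> \<delta>) \<Longrightarrow> x \<in> K \<Longrightarrow> \<bar>J n k f x - J n k g x\<bar> \<le> \<epsilon>"
    using J_equicontinuous[OF assms] by metis
  show thesis
  proof (rule that[OF K'])
    fix t f g x
    assume t: "t \<in> {0..T}" and f: "f \<in> Ckappa_ball \<kappa> r" and g: "g \<in> Ckappa_ball \<kappa> r"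
      and fg: "\<And>y. y \<in> K' \<Longrightarrow> \<bar>f y - g y\<bar> \<le> \<delta>" and x: "x \<in> K"
    have "(\<lambda>n. \<bar>iterate I (h n) t f x - iterate I (h n) t g x\<bar>) \<longlonglongrightarrow> \<bar>S t f x - S t g x\<bar>"
      using t by (intro tendsto_intros S_tendsto ball_Ckappa[OF f] ball_Ckappa[OF g]) auto
    moreover have "\<bar>iterate I (h n) t f x - iterate I (h n) t g x\<bar> \<le> \<epsilon>" for n
      unfolding iterate_J using t num_steps_bounds(1)[OF h_pos[of n], of t]
      by (intro eq f g fg x) auto
    ultimately show "\<bar>S t f x - S t g x\<bar> \<le> \<epsilon>"
      by (intro LIMSEQ_le_const2) auto
  qed
qed

text \<open>Continuity of \<open>S t\<close> along sequences that converge in the mixed topology, by which identities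
  extend from \<open>\<D>\<close> to all functions.\<close>

lemma S_continuous:
  assumes F: "mixed_lim \<kappa> F f" and t: "0 \<le> t"
  shows "mixed_lim \<kappa> (\<lambda>n. S t (F n)) (S t f)"
proof -
  obtain r where r: "\<And>n. F n \<in> Ckappa_ball \<kappa> r"
    using F by (auto simp: mixed_lim_iff)
  have f: "f \<in> Ckappa_ball \<kappa> r"
    by (rule mixed_lim_ball[OF F r])
  show ?thesis
  proof (rule mixed_limI(1))
    show "S t (F n) \<in> Ckappa_ball \<kappa> (radius r t)" for n
      by (rule S_radius[OF r t])
    fix K :: "'a set" assume K: "compact K"
    show "uniform_limit K (\<lambda>n. S t (F n)) (S t f) sequentially"
    proof (rule uniform_limitI)
      fix e :: real assume e: "0 < e"
      then have "0 < e / 2" by simp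
      then obtain K' \<delta> where K': "compact K'" "0 < \<delta>"
        and eq: "\<And>s u v x. s \<in> {0..t} \<Longrightarrow> u \<in> Ckappa_ball \<kappa> r \<Longrightarrow> v \<in> Ckappa_ball \<kappa> r \<Longrightarrow>
           (\<And>y. y \<in> K' \<Longrightarrow> \<bar>u y - v y\<bar> \<le> \<delta>) \<Longrightarrow> x \<in> K \<Longrightarrow> \<bar>S s u x - S s v x\<bar> \<le> e / 2"
        using S_equicontinuous[OF _ ball_nonneg[OF f] t K, of "e / 2"] by metis
      have "\<forall>\<^sub>F n in sequentially. \<forall>x\<in>K'. dist (F n x) (f x) < \<delta>"
        by (rule uniform_limitD[OF mixed_lim_uniform[OF F K'(1)] K'(2)])
      then show "\<forall>\<^sub>F n in sequentially. \<forall>x\<in>K. dist (S t (F n) x) (S t f x) < e"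
      proof eventually_elim
        case (elim n)
        have "\<bar>S t (F n) x - S t f x\<bar> \<le> e / 2" if "x \<in> K" for x
          using elim t that by (intro eq r f) (auto simp: dist_real_def less_imp_le)
        then show ?case
          using e by (fastforce simp: dist_real_def)
      qed
    qed
  qed
qed

text \<open>Needed for \<open>F n = iterate I (h n) s f\<close>, where operators and arguments vary at the same time.\<close>

lemma iterate_tendsto_S:
  assumes F: "mixed_lim \<kappa> F f" and t: "0 \<le> t"
  shows "(\<lambda>n. iterate I (h n) t (F n) x) \<longlonglongrightarrow> S t f x"
proof -
  obtain r where r: "\<And>n. F n \<in> Ckappa_ball \<kappa> r"
    using F by (auto simp: mixed_lim_iff)
  have f: "f \<in> Ckappa_ball \<kappa> r"
    by (rule mixed_lim_ball[OF F r])
  have "(\<lambda>n. iterate I (h n) t (F n) x - iterate I (h n) t f x) \<longlonglongrightarrow> 0"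
  proof (rule tendstoI)
    fix e :: real assume e: "0 < e"
    then have "0 < e / 2" by simp
    then obtain K' \<delta> where K': "compact K'" "0 < \<delta>"
      and eq: "\<And>n k u v y. real k * h n \<le> t \<Longrightarrow> u \<in> Ckappa_ball \<kappa> r \<Longrightarrow> v \<in> Ckappa_ball \<kappa> r \<Longrightarrow>
         (\<And>y. y \<in> K' \<Longrightarrow> \<bar>u y - v y\<bar> \<le> \<delta>) \<Longrightarrow> y \<in> {x} \<Longrightarrow> \<bar>J n k u y - J n k v y\<bar> \<le> e / 2"
      using J_equicontinuous[OF _ ball_nonneg[OF f] t, of "e / 2" "{x}"] by (metis compact_sing)
    have "\<forall>\<^sub>F n in sequentially. \<forall>x\<in>K'. dist (F n x) (f x) < \<delta>"
      by (rule uniform_limitD[OF mixed_lim_uniform[OF F K'(1)] K'(2)])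
    then show "\<forall>\<^sub>F n in sequentially.
        dist (iterate I (h n) t (F n) x - iterate I (h n) t f x) 0 < e"
    proof eventually_elim
      case (elim n)
      have "\<bar>iterate I (h n) t (F n) x - iterate I (h n) t f x\<bar> \<le> e / 2"
        unfolding iterate_J using elim num_steps_bounds(1)[OF h_pos t]
        by (intro eq r f) (auto simp: dist_real_def less_imp_le)
      then show ?case
        using e by simp
    qed
  qed
  from tendsto_add[OF this S_tendsto[OF ball_Ckappa[OF f] t, of x]] show ?thesis
    by simp
qed

lemma S_time_Lipschitz:
  assumes f: "f \<in> Lipschitz_set \<kappa> I" and T: "0 \<le> T"
  obtains C where "0 \<le> C"
    "\<And>s t x. s \<in> {0..T} \<Longrightarrow> t \<in> {0..T} \<Longrightarrow> \<bar>S s f x - S t f x\<bar> * \<kappa> x \<le> C * \<bar>s - t\<bar>"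
proof -
  have fC: "f \<in> Ckappa \<kappa>"
    using f by (simp add: Lipschitz_set_def)
  obtain C N where C: "0 \<le> C"
    and est: "\<And>n s t x. N \<le> n \<Longrightarrow> s \<in> {0..T} \<Longrightarrow> t \<in> {0..T} \<Longrightarrow>
       \<bar>iterate I (h n) s f x - iterate I (h n) t f x\<bar> * \<kappa> x \<le> C * (\<bar>s - t\<bar> + h n)"
    using iterate_time_Lipschitz[OF f T] by metis
  show thesis
  proof (rule that[OF C])
    fix s t x assume st: "s \<in> {0..T}" "t \<in> {0..T}"
    have "(\<lambda>n. C * (\<bar>s - t\<bar> + h n)) \<longlonglongrightarrow> C * (\<bar>s - t\<bar> + 0)"
      by (intro tendsto_intros h_lim)
    then have "(\<lambda>n. C * (\<bar>s - t\<bar> + h n)) \<longlonglongrightarrow> C * \<bar>s - t\<bar>"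
      by simp
    then show "\<bar>S s f x - S t f x\<bar> * \<kappa> x \<le> C * \<bar>s - t\<bar>"
    proof (rule weighted_diff_le_tendsto[OF S_tendsto[OF fC] S_tendsto[OF fC], rotated 2])
      show "\<forall>\<^sub>F n in sequentially. \<bar>iterate I (h n) s f x - iterate I (h n) t f x\<bar> * \<kappa> x
          \<le> C * (\<bar>s - t\<bar> + h n)" for x
        using est[OF _ st] by (auto simp: eventually_sequentially)
    qed (use st in auto)
  qed
qed

text \<open>The step counts of \<open>s\<close> and \<open>t\<close> add up to that of \<open>s + t\<close> up to rounding, so the two
  sides differ by an amount that vanishes with the step size on the functions whose iterates are
  Lipschitz in time; density and continuity give the rest.\<close>

lemma S_semigroup_Lipschitz:
  assumes f: "f \<in> Lipschitz_set \<kappa> I" and s: "0 \<le> s" and t: "0 \<le> t"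
  shows "S (s + t) f = S s (S t f)"
proof
  fix x
  have fC: "f \<in> Ckappa \<kappa>"
    using f by (simp add: Lipschitz_set_def)
  have st: "0 \<le> s + t"
    using s t by simp
  obtain C N where C: "0 \<le> C"
    and est: "\<And>n j k x. N \<le> n \<Longrightarrow> real j * h n \<le> s + t \<Longrightarrow> real k * h n \<le> s + t \<Longrightarrow>
       \<bar>J n j f x - J n k f x\<bar> * \<kappa> x \<le> C * \<bar>real j * h n - real k * h n\<bar>"
    using J_time_Lipschitz[OF f st] by metis
  have "(\<lambda>n. C * (2 * h n)) \<longlonglongrightarrow> C * (2 * 0)"
    by (intro tendsto_intros h_lim)
  then have lim: "(\<lambda>n. C * (2 * h n)) \<longlonglongrightarrow> 0"
    by simp
  have "\<bar>S (s + t) f x - S s (S t f) x\<bar> * \<kappa> x \<le> 0"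
  proof (rule weighted_diff_le_tendsto[OF S_tendsto[OF fC st]
        iterate_tendsto_S[OF S_lim[OF fC t] s] lim])
    fix x
    have "\<bar>iterate I (h n) (s + t) f x - iterate I (h n) s (iterate I (h n) t f) x\<bar> * \<kappa> x
        \<le> C * (2 * h n)" if n: "N \<le> n" for n
    proof -
      let ?k = "num_steps (h n)"
      note b = num_steps_bounds[OF h_pos[of n]]
      have eq: "iterate I (h n) s (iterate I (h n) t f) = J n (?k s + ?k t) f"
        by (simp add: iterate_J funpow_add)
      have sum: "real (?k s + ?k t) * h n = real (?k s) * h n + real (?k t) * h n"
        by (simp add: distrib_right)
      have "\<bar>real (?k (s + t)) * h n - real (?k s + ?k t) * h n\<bar> \<le> 2 * h n"
        unfolding sum using b[OF s] b[OF t] b[OF st] by linarith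
      then have "C * \<bar>real (?k (s + t)) * h n - real (?k s + ?k t) * h n\<bar> \<le> C * (2 * h n)"
        using C by (rule mult_left_mono)
      moreover have "real (?k s + ?k t) * h n \<le> s + t"
        unfolding sum using b(1)[OF s] b(1)[OF t] by linarith
      ultimately show ?thesis
        unfolding eq using est[OF n b(1)[OF st], of "?k s + ?k t" x] by (simp add: iterate_J)
    qed
    then show "\<forall>\<^sub>F n in sequentially.
        \<bar>iterate I (h n) (s + t) f x - iterate I (h n) s (iterate I (h n) t f) x\<bar> * \<kappa> x
          \<le> C * (2 * h n)"
      by (auto simp: eventually_sequentially)
  qed
  then have "\<bar>S (s + t) f x - S s (S t f) x\<bar> \<le> 0"
    using kappa_pos[of x] by (simp add: mult_le_0_iff)
  then show "S (s + t) f x = S s (S t f) x"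
    by simp
qed

lemma S_semigroup:
  assumes f: "f \<in> Ckappa \<kappa>" and s: "0 \<le> s" and t: "0 \<le> t"
  shows "S (s + t) f = S s (S t f)"
proof -
  obtain F where F: "\<And>n. F n \<in> \<D>" "mixed_lim \<kappa> F f"
    using D_dense[OF f] by blast
  have "S (s + t) (F n) = S s (S t (F n))" for n
    using F(1) D_Lipschitz by (intro S_semigroup_Lipschitz s t) auto
  then have "mixed_lim \<kappa> (\<lambda>n. S (s + t) (F n)) (S s (S t f))"
    using S_continuous[OF S_continuous[OF F(2) t] s] by simp
  then show ?thesis
    using mixed_lim_unique[OF S_continuous[OF F(2), of "s + t"]] s t by simp
qed

text \<open>Approximation by a function of \<open>\<D>\<close>, which is Lipschitz in time; tightness makes the
  approximation error uniform over the bounded set of times \<open>s n\<close>.\<close>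

lemma S_time_continuous:
  assumes f: "f \<in> Ckappa \<kappa>" and s: "\<And>n. 0 \<le> s n" "s \<longlonglongrightarrow> t"
  shows "mixed_lim \<kappa> (\<lambda>n. S (s n) f) (S t f)"
proof -
  let ?r = "kappa_norm \<kappa> f"
  have t: "0 \<le> t"
    by (rule LIMSEQ_le_const[OF s(2)]) (use s(1) in blast)
  have "bounded (range s)"
    by (rule convergent_imp_bounded[OF s(2)])
  then obtain T where T: "\<And>n. s n \<le> T"
    by (metis bounded_real abs_le_D1 rangeI)
  have tT: "t \<le> T"
    by (rule LIMSEQ_le_const2[OF s(2)]) (use T in blast)
  have T0: "0 \<le> T"
    using t tT by simp
  have fr: "f \<in> Ckappa_ball \<kappa> ?r" and r: "0 \<le> ?r"
    using f by (simp_all add: Ckappa_in_ball kappa_norm_nonneg)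
  show ?thesis
  proof (rule mixed_limI(1))
    show "S (s n) f \<in> Ckappa_ball \<kappa> (radius ?r T)" for n
      by (rule ball_mono[OF S_radius[OF fr s(1)] radius_mono[OF r s(1) T]])
    fix K :: "'a set" assume K: "compact K"
    show "uniform_limit K (\<lambda>n. S (s n) f) (S t f) sequentially"
    proof (rule uniform_limitI)
      fix e :: real assume e: "0 < e"
      then have "0 < e / 4" by simp
      then obtain K' \<delta> where K': "compact K'" "0 < \<delta>"
        and eq: "\<And>s u v x. s \<in> {0..T} \<Longrightarrow> u \<in> Ckappa_ball \<kappa> ?r \<Longrightarrow> v \<in> Ckappa_ball \<kappa> ?r \<Longrightarrow>
           (\<And>y. y \<in> K' \<Longrightarrow> \<bar>u y - v y\<bar> \<le> \<delta>) \<Longrightarrow> x \<in> K \<Longrightarrow> \<bar>S s u x - S s v x\<bar> \<le> e / 4"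
        using S_equicontinuous[OF _ r T0 K, of "e / 4"] by metis
      obtain g where g: "g \<in> \<D>" "g \<in> Ckappa_ball \<kappa> ?r" "\<And>x. x \<in> K' \<Longrightarrow> \<bar>g x - f x\<bar> \<le> \<delta>"
        using approximate_in_D[OF f K'] by blast
      obtain C where C: "0 \<le> C"
        and lip: "\<And>s t x. s \<in> {0..T} \<Longrightarrow> t \<in> {0..T} \<Longrightarrow> \<bar>S s g x - S t g x\<bar> * \<kappa> x \<le> C * \<bar>s - t\<bar>"
        using S_time_Lipschitz[OF _ T0, of g] g(1) D_Lipschitz by (metis subsetD)
      obtain a where a: "0 < a" "\<And>x. x \<in> K \<Longrightarrow> a \<le> \<kappa> x"
        using compact_kappa_lower[OF K] by blast
      have "(\<lambda>n. C * \<bar>s n - t\<bar>) \<longlonglongrightarrow> C * \<bar>t - t\<bar>"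
        by (intro tendsto_intros s(2))
      moreover have "C * \<bar>t - t\<bar> < a * (e / 4)"
        using a(1) e by simp
      ultimately have "\<forall>\<^sub>F n in sequentially. C * \<bar>s n - t\<bar> < a * (e / 4)"
        by (rule order_tendstoD)
      then show "\<forall>\<^sub>F n in sequentially. \<forall>x\<in>K. dist (S (s n) f x) (S t f x) < e"
      proof (eventually_elim, intro ballI)
        fix n x assume n: "C * \<bar>s n - t\<bar> < a * (e / 4)" and x: "x \<in> K"
        have sn: "s n \<in> {0..T}" and tT': "t \<in> {0..T}"
          using s(1) T t tT by auto
        have "\<bar>S (s n) g x - S t g x\<bar> * a \<le> \<bar>S (s n) g x - S t g x\<bar> * \<kappa> x"
          using a(2)[OF x] by (intro mult_left_mono) auto
        also have "\<dots> \<le> C * \<bar>s n - t\<bar>"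
          by (rule lip[OF sn tT'])
        finally have "\<bar>S (s n) g x - S t g x\<bar> * a \<le> e / 4 * a"
          using n by (simp add: mult.commute)
        then have "\<bar>S (s n) g x - S t g x\<bar> \<le> e / 4"
          using a(1) by (meson mult_le_cancel_right_pos)
        moreover have "\<bar>S (s n) g x - S (s n) f x\<bar> \<le> e / 4" "\<bar>S t g x - S t f x\<bar> \<le> e / 4"
          using eq[OF sn g(2) fr g(3) x] eq[OF tT' g(2) fr g(3) x] by blast+
        ultimately show "dist (S (s n) f x) (S t f x) < e"
          using e unfolding dist_real_def by linarith
      qed
    qed
  qed
qed

lemma S_jointly_continuous:
  assumes f: "f \<in> Ckappa \<kappa>" and s: "\<And>n. 0 \<le> s n" "s \<longlonglongrightarrow> t" and y: "y \<longlonglongrightarrow> x"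
  shows "(\<lambda>n. S (s n) f (y n)) \<longlonglongrightarrow> S t f x"
proof -
  let ?K = "insert x (range y)"
  have lim: "mixed_lim \<kappa> (\<lambda>n. S (s n) f) (S t f)"
    by (rule S_time_continuous[OF f s])
  have u: "uniform_limit ?K (\<lambda>n. S (s n) f) (S t f) sequentially"
    by (rule mixed_lim_uniform[OF lim compact_insert_limit_range[OF y]])
  have "(\<lambda>n. S (s n) f (y n) - S t f (y n)) \<longlonglongrightarrow> 0"
  proof (rule tendstoI)
    fix e :: real assume "0 < e"
    from uniform_limitD[OF u this] show "\<forall>\<^sub>F n in sequentially. dist (S (s n) f (y n) - S t f (y n)) 0 < e"
      by eventually_elim (auto simp: dist_real_def)
  qed
  moreover have "(\<lambda>n. S t f (y n)) \<longlonglongrightarrow> S t f x"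
    by (rule continuous_on_tendsto_compose[OF Ckappa_cont[OF mixed_lim_Ckappa(1)[OF lim]] y]) auto
  ultimately show ?thesis
    using tendsto_add by fastforce
qed

lemma S_continuous_from_above:
  assumes F: "\<And>n. F n \<in> Ckappa \<kappa>" and dec: "decreases_to_0 F" and t: "0 \<le> t"
  shows "decreases_to_0 (\<lambda>n. S t (F n))"
proof -
  have anti: "F n x \<le> F m x" if "m \<le> n" for m n x
    using dec that by (auto simp: decreases_to_0_def decseq_def)
  have pos: "0 \<le> F n x" for n x
    using dec decseq_ge[of "\<lambda>n. F n x" 0 n] by (auto simp: decreases_to_0_def)
  have "\<bar>F n x\<bar> * \<kappa> x \<le> kappa_norm \<kappa> (F 0)" for n x
  proof -
    have "\<bar>F n x\<bar> * \<kappa> x \<le> \<bar>F 0 x\<bar> * \<kappa> x"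
      using pos[of n x] anti[of 0 n x] by (intro mult_right_mono) auto
    then show ?thesis
      using kappa_norm_upper[OF F[of 0], of x] by linarith
  qed
  then have "F n \<in> Ckappa_ball \<kappa> (kappa_norm \<kappa> (F 0))" for n
    using Ckappa_cont[OF F] by (simp add: Ckappa_ball_iff)
  then have "mixed_lim \<kappa> F (\<lambda>x. 0)"
    by (rule mixed_limI(1)) (intro decreases_to_0_imp_uniform_limit Ckappa_cont F dec)
  then have "mixed_lim \<kappa> (\<lambda>n. S t (F n)) (\<lambda>x. 0)"
    using S_continuous[OF _ t] S_zero[OF t] by fastforce
  then show ?thesis
    using mixed_lim_tendsto by (auto simp: decreases_to_0_def decseq_def intro!: S_mono F anti t)
qed

lemma S_convex_monotone_semigroup: "convex_monotone_semigroup \<kappa> S"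
  unfolding convex_monotone_semigroup_def
proof (intro conjI allI impI ballI)
  show "operator_family \<kappa> S"
    by (auto simp: operator_family_def S_Ckappa)
  show "convex_operator \<kappa> (S t)" if "0 \<le> t" for t
    by (rule S_convex[OF that])
  show "monotone_operator \<kappa> (S t)" if "0 \<le> t" for t
    using that by (auto simp: monotone_operator_def mono_on_def le_fun_def intro!: S_mono)
  show "decreases_to_0 (\<lambda>n. S t (F n))"
    if "0 \<le> t" "(\<forall>n. F n \<in> Ckappa \<kappa>) \<and> decreases_to_0 F" for t F
    using that by (intro S_continuous_from_above) auto
  show "S 0 f = f" if "f \<in> Ckappa \<kappa>" for f
    by (rule S_0[OF that])
  show "S (s + t) f = S s (S t f)" if "0 \<le> s" "0 \<le> t" "f \<in> Ckappa \<kappa>" for s t f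
    by (rule S_semigroup[OF that(3,1,2)])
  show "bdd_above ((\<lambda>t. kappa_norm \<kappa> (S t (\<lambda>x. r / \<kappa> x))) ` {0..T})" if "0 \<le> r" "0 \<le> T" for r T
  proof (rule bdd_aboveI2)
    fix t assume t: "t \<in> {0..T}"
    have "(\<lambda>x. r / \<kappa> x) \<in> Ckappa_ball \<kappa> r"
      using that kappa_pos less_imp_neq[OF kappa_pos]
      by (auto simp: Ckappa_ball_iff abs_mult intro!: continuous_intros kappa_cont)
    then have "S t (\<lambda>x. r / \<kappa> x) \<in> Ckappa_ball \<kappa> (radius r T)"
      using t by (intro ball_mono[OF S_radius radius_mono] that) auto
    then show "kappa_norm \<kappa> (S t (\<lambda>x. r / \<kappa> x)) \<le> radius r T"
      by (simp add: Ckappa_ball_def)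
  qed
  show "limsup (\<lambda>n. ereal (S (s n) f (y n))) \<le> ereal (S t f x)"
    if "0 \<le> t" "f \<in> Ckappa \<kappa>" "(\<forall>n. 0 \<le> s n) \<and> s \<longlonglongrightarrow> t \<and> y \<longlonglongrightarrow> x" for t f x s y
  proof -
    have "(\<lambda>n. S (s n) f (y n)) \<longlonglongrightarrow> S t f x"
      using that by (intro S_jointly_continuous) auto
    then have "limsup (\<lambda>n. ereal (S (s n) f (y n))) = ereal (S t f x)"
      by (intro lim_imp_Limsup tendsto_ereal) simp
    then show ?thesis
      by simp
  qed
qed

lemma S_strongly_continuous: "strongly_continuous \<kappa> S"
  unfolding strongly_continuous_def
  using S_time_continuous[where t = 0] S_0 by fastforce

end

section \<open>The generator\<close>

lemma (in weight) has_deriv0_unique: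
  assumes "has_deriv0 \<kappa> S f g" "has_deriv0 \<kappa> S f g'"
  shows "g = g'"
proof -
  have h: "(\<forall>n. 0 < inverse (real (Suc n))) \<and> (\<lambda>n. inverse (real (Suc n))) \<longlonglongrightarrow> 0"
    using LIMSEQ_inverse_real_of_nat by simp
  show ?thesis
    by (rule mixed_lim_unique[OF assms[unfolded has_deriv0_def, THEN spec, THEN mp, OF h]])
qed

lemma (in weight) deriv0_eq: "has_deriv0 \<kappa> S f g \<Longrightarrow> deriv0 \<kappa> S f = g"
  unfolding deriv0_def by (rule the_equality) (auto intro: has_deriv0_unique)

context iteration_limit
begin

text \<open>Boundedness of the difference quotients along every null sequence is boundedness near
  \<open>0\<close>.\<close>

lemma has_deriv0_imp_Lipschitz:
  assumes f: "f \<in> Ckappa \<kappa>" and g: "has_deriv0 \<kappa> I f g"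
  shows "f \<in> Lipschitz_set \<kappa> I"
proof (rule ccontr)
  assume neg: "f \<notin> Lipschitz_set \<kappa> I"
  have "\<exists>t. 0 < t \<and> t \<le> inverse (real (Suc n)) \<and> real n * t < kappa_norm \<kappa> (\<lambda>x. I t f x - f x)" for n
  proof -
    \<comment> \<open>failure of the Lipschitz estimate with constant \<open>n\<close> on \<open>[0, 1 / (n + 1)]\<close>\<close>
    have "\<exists>t\<in>{0..inverse (real (Suc n))}. \<not> kappa_norm \<kappa> (\<lambda>x. I t f x - f x) \<le> real n * t"
      using neg f by (auto simp: Lipschitz_set_def dest!: spec[of _ "real n"] spec[of _ "inverse (real (Suc n))"])
    then obtain t where t: "0 \<le> t" "t \<le> inverse (real (Suc n))"
      "real n * t < kappa_norm \<kappa> (\<lambda>x. I t f x - f x)"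
      by auto
    moreover have "t \<noteq> 0"
      using t(3) I_id[OF f] kappa_norm_least[of "\<lambda>x. 0" 0] by auto
    ultimately show ?thesis
      by (intro exI[of _ t]) simp
  qed
  then obtain t where t: "\<And>n. 0 < t n" "\<And>n. t n \<le> inverse (real (Suc n))"
    and big: "\<And>n. real n * t n < kappa_norm \<kappa> (\<lambda>x. I (t n) f x - f x)"
    by metis
  have "t \<longlonglongrightarrow> 0"
    by (rule tendsto_sandwich[OF _ _ tendsto_const LIMSEQ_inverse_real_of_nat])
      (use t in \<open>auto intro!: always_eventually less_imp_le\<close>)
  then have "mixed_lim \<kappa> (\<lambda>n x. (I (t n) f x - f x) / t n) g"
    using g t(1) by (simp add: has_deriv0_def)
  then obtain r where r: "\<And>n. (\<lambda>x. (I (t n) f x - f x) / t n) \<in> Ckappa_ball \<kappa> r"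
    by (auto simp: mixed_lim_iff)
  obtain n where n: "r < real n"
    using reals_Archimedean2 by blast
  have "\<bar>I (t n) f x - f x\<bar> * \<kappa> x \<le> r * t n" for x
    using ball_bound[OF r[of n], of x] t(1)[of n] by (simp add: abs_div_pos[symmetric] field_simps)
  then have "kappa_norm \<kappa> (\<lambda>x. I (t n) f x - f x) \<le> r * t n"
    by (rule kappa_norm_least)
  moreover have "r * t n \<le> real n * t n"
    using n t(1)[of n] by (intro mult_right_mono) auto
  ultimately show False
    using big[of n] by linarith
qed

text \<open>For a convex functional the slope over the short segment from \<open>f\<close> to \<open>f + c * q\<close> lies between
  the slopes over the unit segments from \<open>f - q\<close> to \<open>f\<close> and from \<open>f\<close> to \<open>f + q\<close>.  With the step
  size as \<open>c\<close> and the difference quotient as \<open>q\<close>, this trades increments of order \<open>h n\<close>, on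
  which equicontinuity says nothing after division by \<open>h n\<close>, for increments of order one.\<close>

lemma J_increment_bounds:
  assumes f: "f \<in> Ckappa \<kappa>" and q: "q \<in> Ckappa \<kappa>" and c: "0 < c" "c \<le> 1"
  shows "J n k (\<lambda>y. f y + c * q y) x - J n k f x \<le> c * (J n k (\<lambda>y. f y + q y) x - J n k f x)"
    and "c * (J n k f x - J n k (\<lambda>y. f y - q y) x) \<le> J n k (\<lambda>y. f y + c * q y) x - J n k f x"
proof -
  note cv = J_convex[of k n, unfolded convex_operator_def, rule_format]
  have cq: "(\<lambda>y. c * q y) \<in> Ckappa \<kappa>"
    by (rule Ckappa_scale[OF q])
  have "J n k (\<lambda>y. c * (f y + q y) + (1 - c) * f y) x
      \<le> c * J n k (\<lambda>y. f y + q y) x + (1 - c) * J n k f x"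
    using c by (intro cv Ckappa_add f q) auto
  moreover have "(\<lambda>y. c * (f y + q y) + (1 - c) * f y) = (\<lambda>y. f y + c * q y)"
    by (simp add: fun_eq_iff algebra_simps)
  ultimately show "J n k (\<lambda>y. f y + c * q y) x - J n k f x
      \<le> c * (J n k (\<lambda>y. f y + q y) x - J n k f x)"
    by (simp add: algebra_simps)
  \<comment> \<open>\<open>f\<close> is the convex combination of \<open>f + c * q\<close> and \<open>f - q\<close> with weights \<open>b\<close> and \<open>1 - b\<close>\<close>
  define b where "b = 1 / (1 + c)"
  have b: "0 \<le> b" "b \<le> 1" "(1 + c) * b = 1" "(1 + c) * (1 - b) = c"
    using c by (auto simp: b_def field_simps)
  have "J n k (\<lambda>y. b * (f y + c * q y) + (1 - b) * (f y - q y)) x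
      \<le> b * J n k (\<lambda>y. f y + c * q y) x + (1 - b) * J n k (\<lambda>y. f y - q y) x"
    using b by (intro cv Ckappa_add Ckappa_diff f q cq) auto
  moreover have "b * (f y + c * q y) + (1 - b) * (f y - q y) = f y" for y
  proof -
    have "b * (f y + c * q y) + (1 - b) * (f y - q y) = f y + ((1 + c) * b - 1) * q y"
      by (simp add: algebra_simps)
    then show ?thesis
      using b(3) by simp
  qed
  ultimately have "J n k f x
      \<le> b * J n k (\<lambda>y. f y + c * q y) x + (1 - b) * J n k (\<lambda>y. f y - q y) x"
    by simp
  then have "(1 + c) * J n k f x
      \<le> (1 + c) * (b * J n k (\<lambda>y. f y + c * q y) x + (1 - b) * J n k (\<lambda>y. f y - q y) x)"
    using c by (intro mult_left_mono) auto
  also have "\<dots> = J n k (\<lambda>y. f y + c * q y) x + c * J n k (\<lambda>y. f y - q y) x"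
    by (simp add: distrib_left mult.assoc[symmetric] b)
  finally show "c * (J n k f x - J n k (\<lambda>y. f y - q y) x)
      \<le> J n k (\<lambda>y. f y + c * q y) x - J n k f x"
    by (simp add: algebra_simps)
qed

text \<open>Each of the \<open>k\<close> increments equals \<open>h n * g\<close> up to an error \<open>h n * \<epsilon>\<close>; the error is made of
  three parts of size \<open>\<epsilon> / 3\<close>: replacing the difference quotient by its limit \<open>g\<close>, and the
  movement of \<open>f \<plusminus> g\<close> and of \<open>f\<close> in small time.\<close>

lemma J_first_order:
  assumes f: "f \<in> Ckappa \<kappa>" and g: "has_deriv0 \<kappa> I f g" and K: "compact K" and \<epsilon>: "0 < \<epsilon>"
  obtains \<delta> N where "0 < \<delta>"
    "\<And>n k x. N \<le> n \<Longrightarrow> real k * h n \<le> \<delta> \<Longrightarrow> x \<in> K \<Longrightarrow>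
       \<bar>J n k f x - f x - real k * h n * g x\<bar> \<le> real k * h n * \<epsilon>"
proof -
  define q where "q n = (\<lambda>x. (I (h n) f x - f x) / h n)" for n
  have q: "mixed_lim \<kappa> q g"
    using g h_pos h_lim unfolding has_deriv0_def q_def by simp
  then obtain s where qs: "\<And>n. q n \<in> Ckappa_ball \<kappa> s"
    by (auto simp: mixed_lim_iff)
  have gs: "g \<in> Ckappa_ball \<kappa> s"
    by (rule mixed_lim_ball[OF q qs])
  define r where "r = kappa_norm \<kappa> f + s"
  note fb = Ckappa_in_ball[OF f]
  have If: "I (h n) f = (\<lambda>y. f y + h n * q n y)" for n
    using h_pos[of n] by (simp add: q_def fun_eq_iff)
  have r: "0 \<le> r"
    using ball_nonneg[OF ball_add[OF fb gs]] by (simp add: r_def)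
  have e3: "0 < \<epsilon> / 3"
    using \<epsilon> by simp
  obtain K' \<eta> where K': "compact K'" "0 < \<eta>"
    and eq: "\<And>n k u v x. real k * h n \<le> 1 \<Longrightarrow> u \<in> Ckappa_ball \<kappa> r \<Longrightarrow> v \<in> Ckappa_ball \<kappa> r \<Longrightarrow>
       (\<And>y. y \<in> K' \<Longrightarrow> \<bar>u y - v y\<bar> \<le> \<eta>) \<Longrightarrow> x \<in> K \<Longrightarrow> \<bar>J n k u x - J n k v x\<bar> \<le> \<epsilon> / 3"
    using J_equicontinuous[OF e3 r zero_le_one K] by metis
  have small: "\<exists>\<delta> N. 0 < \<delta> \<and> (\<forall>n k x. N \<le> n \<longrightarrow> real k * h n \<le> \<delta> \<longrightarrow> x \<in> K \<longrightarrow> \<bar>J n k u x - u x\<bar> \<le> \<epsilon> / 3)"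
    if "u \<in> Ckappa \<kappa>" for u
    using J_small_time[OF that K e3] by metis
  note gC = ball_Ckappa[OF gs]
  obtain \<delta>0 N0 where d0: "0 < \<delta>0" "\<And>n k x. N0 \<le> n \<Longrightarrow> real k * h n \<le> \<delta>0 \<Longrightarrow> x \<in> K \<Longrightarrow>
      \<bar>J n k f x - f x\<bar> \<le> \<epsilon> / 3"
    using small[OF f] by blast
  obtain \<delta>1 N1 where d1: "0 < \<delta>1" "\<And>n k x. N1 \<le> n \<Longrightarrow> real k * h n \<le> \<delta>1 \<Longrightarrow> x \<in> K \<Longrightarrow>
      \<bar>J n k (\<lambda>y. f y + g y) x - (f x + g x)\<bar> \<le> \<epsilon> / 3"
    using small[OF Ckappa_add[OF f gC]] by blast
  obtain \<delta>2 N2 where d2: "0 < \<delta>2" "\<And>n k x. N2 \<le> n \<Longrightarrow> real k * h n \<le> \<delta>2 \<Longrightarrow> x \<in> K \<Longrightarrow>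
      \<bar>J n k (\<lambda>y. f y - g y) x - (f x - g x)\<bar> \<le> \<epsilon> / 3"
    using small[OF Ckappa_diff[OF f gC]] by blast
  have "\<forall>\<^sub>F n in sequentially. \<forall>x\<in>K'. dist (q n x) (g x) < \<eta>"
    by (rule uniform_limitD[OF mixed_lim_uniform[OF q K'(1)] K'(2)])
  moreover have "\<forall>\<^sub>F n in sequentially. h n < 1"
    using h_lim by (rule order_tendstoD) simp
  ultimately have "\<forall>\<^sub>F n in sequentially. (\<forall>x\<in>K'. dist (q n x) (g x) < \<eta>) \<and> h n < 1"
    by (rule eventually_conj)
  then obtain N3 where N3: "\<And>n x. N3 \<le> n \<Longrightarrow> x \<in> K' \<Longrightarrow> \<bar>q n x - g x\<bar> \<le> \<eta>"
    "\<And>n. N3 \<le> n \<Longrightarrow> h n \<le> 1"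
    by (force simp: eventually_sequentially dist_real_def)
  define \<delta> where "\<delta> = Min {1, \<delta>0, \<delta>1, \<delta>2}"
  have \<delta>: "0 < \<delta>" "\<delta> \<le> 1" "\<delta> \<le> \<delta>0" "\<delta> \<le> \<delta>1" "\<delta> \<le> \<delta>2"
    using d0(1) d1(1) d2(1) by (auto simp: \<delta>_def)
  define N where "N = Max {N0, N1, N2, N3}"
  show thesis
  proof (rule that[OF \<delta>(1)])
    fix n k x
    assume n: "N \<le> n" and k: "real k * h n \<le> \<delta>" and x: "x \<in> K"
    have n': "N0 \<le> n" "N1 \<le> n" "N2 \<le> n" "N3 \<le> n"
      using n by (auto simp: N_def)
    note qC = ball_Ckappa[OF qs[of n]]
    show "\<bar>J n k f x - f x - real k * h n * g x\<bar> \<le> real k * h n * \<epsilon>"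
      using k
    proof (induction k)
      case 0
      then show ?case by simp
    next
      case (Suc k)
      have k: "real k * h n \<le> \<delta>"
        using Suc.prems h_pos[of n] by (simp add: algebra_simps)
      let ?d = "J n (Suc k) f x - J n k f x"
      have d: "?d = J n k (\<lambda>y. f y + h n * q n y) x - J n k f x"
        by (simp add: funpow_swap1 If)
      have plus: "\<bar>J n k (\<lambda>y. f y + q n y) x - J n k (\<lambda>y. f y + g y) x\<bar> \<le> \<epsilon> / 3"
        using k \<delta> N3(1)[OF n'(4)] ball_add[OF fb qs[of n]] ball_add[OF fb gs]
        by (intro eq x) (auto simp: r_def)
      have minus: "\<bar>J n k (\<lambda>y. f y - q n y) x - J n k (\<lambda>y. f y - g y) x\<bar> \<le> \<epsilon> / 3"
        using k \<delta> N3(1)[OF n'(4)] ball_diff[OF fb qs[of n]] ball_diff[OF fb gs]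
        by (intro eq x) (auto simp: r_def abs_minus_commute)
      have s0: "\<bar>J n k f x - f x\<bar> \<le> \<epsilon> / 3"
        using k \<delta> by (intro d0(2) n' x) auto
      have s1: "\<bar>J n k (\<lambda>y. f y + g y) x - (f x + g x)\<bar> \<le> \<epsilon> / 3"
        using k \<delta> by (intro d1(2) n' x) auto
      have s2: "\<bar>J n k (\<lambda>y. f y - g y) x - (f x - g x)\<bar> \<le> \<epsilon> / 3"
        using k \<delta> by (intro d2(2) n' x) auto
      note inc = J_increment_bounds[OF f qC h_pos N3(2)[OF n'(4)], of k n x]
      have "?d \<le> h n * (J n k (\<lambda>y. f y + q n y) x - J n k f x)"
        using inc(1) d by simp
      also have "\<dots> \<le> h n * (g x + \<epsilon>)"
        using plus s0 s1 by (intro mult_left_mono h_nonneg) linarith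
      finally have up: "?d \<le> h n * (g x + \<epsilon>)" .
      have "h n * (g x - \<epsilon>) \<le> h n * (J n k f x - J n k (\<lambda>y. f y - q n y) x)"
        using minus s0 s2 by (intro mult_left_mono h_nonneg) linarith
      also have "\<dots> \<le> ?d"
        using inc(2) d by simp
      finally have low: "h n * (g x - \<epsilon>) \<le> ?d" .
      have "\<bar>?d - h n * g x\<bar> \<le> h n * \<epsilon>"
        using up low by (simp add: abs_le_iff algebra_simps)
      moreover have "J n (Suc k) f x - f x - real (Suc k) * h n * g x
          = (?d - h n * g x) + (J n k f x - f x - real k * h n * g x)"
        by (simp add: algebra_simps)
      ultimately have "\<bar>J n (Suc k) f x - f x - real (Suc k) * h n * g x\<bar>
          \<le> h n * \<epsilon> + real k * h n * \<epsilon>"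
        using Suc.IH[OF k] by linarith
      then show ?case
        by (simp add: algebra_simps)
    qed
  qed
qed

lemma num_steps_tendsto:
  assumes "0 \<le> t"
  shows "(\<lambda>n. real (num_steps (h n) t) * h n) \<longlonglongrightarrow> t"
proof (rule tendsto_sandwich[of "\<lambda>n. t - h n" _ _ "\<lambda>n. t"])
  have "(\<lambda>n. t - h n) \<longlonglongrightarrow> t - 0"
    by (intro tendsto_intros h_lim)
  then show "(\<lambda>n. t - h n) \<longlonglongrightarrow> t"
    by simp
  have "t - h n \<le> real (num_steps (h n) t) * h n \<and> real (num_steps (h n) t) * h n \<le> t" for n
    using num_steps_bounds[OF h_pos[of n] assms] by linarith
  then show "\<forall>\<^sub>F n in sequentially. t - h n \<le> real (num_steps (h n) t) * h n"
    "\<forall>\<^sub>F n in sequentially. real (num_steps (h n) t) * h n \<le> t"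
    by (auto intro: always_eventually)
qed simp

lemma S_first_order:
  assumes f: "f \<in> Ckappa \<kappa>" and g: "has_deriv0 \<kappa> I f g" and K: "compact K" and \<epsilon>: "0 < \<epsilon>"
  obtains \<delta> where "0 < \<delta>"
    "\<And>t x. t \<in> {0..\<delta>} \<Longrightarrow> x \<in> K \<Longrightarrow> \<bar>S t f x - f x - t * g x\<bar> \<le> t * \<epsilon>"
proof -
  obtain \<delta> N where \<delta>: "0 < \<delta>"
    and est: "\<And>n k x. N \<le> n \<Longrightarrow> real k * h n \<le> \<delta> \<Longrightarrow> x \<in> K \<Longrightarrow>
       \<bar>J n k f x - f x - real k * h n * g x\<bar> \<le> real k * h n * \<epsilon>"
    using J_first_order[OF assms] by metis
  show thesis
  proof (rule that[OF \<delta>])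
    fix t x assume t: "t \<in> {0..\<delta>}" and x: "x \<in> K"
    let ?t = "\<lambda>n. real (num_steps (h n) t) * h n"
    have t0: "0 \<le> t"
      using t by simp
    have l1: "(\<lambda>n. \<bar>iterate I (h n) t f x - f x - ?t n * g x\<bar>) \<longlonglongrightarrow> \<bar>S t f x - f x - t * g x\<bar>"
      by (intro tendsto_intros S_tendsto[OF f t0] num_steps_tendsto[OF t0])
    have l2: "(\<lambda>n. ?t n * \<epsilon>) \<longlonglongrightarrow> t * \<epsilon>"
      by (intro tendsto_intros num_steps_tendsto[OF t0])
    show "\<bar>S t f x - f x - t * g x\<bar> \<le> t * \<epsilon>"
    proof (rule LIMSEQ_le[OF l1 l2], intro exI allI impI)
      fix n assume "N \<le> n"
      then show "\<bar>iterate I (h n) t f x - f x - ?t n * g x\<bar> \<le> ?t n * \<epsilon>"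
        unfolding iterate_J using num_steps_bounds(1)[OF h_pos[of n] t0] t x by (intro est) auto
    qed
  qed
qed

lemma has_deriv0_S:
  assumes f: "f \<in> Ckappa \<kappa>" and g: "has_deriv0 \<kappa> I f g"
  shows "has_deriv0 \<kappa> S f g"
  unfolding has_deriv0_def
proof (intro allI impI)
  fix t :: "nat \<Rightarrow> real" assume "(\<forall>n. 0 < t n) \<and> t \<longlonglongrightarrow> 0"
  then have t: "\<And>n. 0 < t n" and lim: "t \<longlonglongrightarrow> 0"
    by auto
  have "bounded (range t)"
    by (rule convergent_imp_bounded[OF lim])
  then obtain T where T: "\<And>n. t n \<le> T"
    by (metis bounded_real abs_le_D1 rangeI)
  then have T0: "0 \<le> T"
    using t by (meson less_imp_le order_trans)
  obtain C where C: "0 \<le> C"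
    and lip: "\<And>s t x. s \<in> {0..T} \<Longrightarrow> t \<in> {0..T} \<Longrightarrow> \<bar>S s f x - S t f x\<bar> * \<kappa> x \<le> C * \<bar>s - t\<bar>"
    using S_time_Lipschitz[OF has_deriv0_imp_Lipschitz[OF f g] T0] by metis
  show "mixed_lim \<kappa> (\<lambda>n x. (S (t n) f x - f x) / t n) g"
  proof (rule mixed_limI(1))
    fix n
    have "\<bar>(S (t n) f x - f x) / t n\<bar> * \<kappa> x \<le> C" for x
    proof -
      have "\<bar>S (t n) f x - f x\<bar> * \<kappa> x \<le> C * t n"
        using lip[of "t n" 0 x] t[of n] T[of n] T0 by (simp add: S_0[OF f])
      then show ?thesis
        using t[of n] by (simp add: field_simps)
    qed
    moreover have "continuous_on UNIV (\<lambda>x. (S (t n) f x - f x) / t n)"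
      using t[of n] by (intro continuous_intros Ckappa_cont S_Ckappa f) auto
    ultimately show "(\<lambda>x. (S (t n) f x - f x) / t n) \<in> Ckappa_ball \<kappa> C"
      by (simp add: Ckappa_ball_iff)
  next
    fix K :: "'a set" assume K: "compact K"
    show "uniform_limit K (\<lambda>n x. (S (t n) f x - f x) / t n) g sequentially"
    proof (rule uniform_limitI)
      fix e :: real assume e: "0 < e"
      then have "0 < e / 2" by simp
      then obtain \<delta> where \<delta>: "0 < \<delta>"
        and est: "\<And>t x. t \<in> {0..\<delta>} \<Longrightarrow> x \<in> K \<Longrightarrow> \<bar>S t f x - f x - t * g x\<bar> \<le> t * (e / 2)"
        using S_first_order[OF f g K] by metis
      have "\<forall>\<^sub>F n in sequentially. t n < \<delta>"
        using lim \<delta> by (rule order_tendstoD)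
      then show "\<forall>\<^sub>F n in sequentially. \<forall>x\<in>K. dist ((S (t n) f x - f x) / t n) (g x) < e"
      proof (eventually_elim, intro ballI)
        fix n x assume n: "t n < \<delta>" and x: "x \<in> K"
        have "(S (t n) f x - f x) / t n - g x = (S (t n) f x - f x - t n * g x) / t n"
          using t[of n] by (simp add: field_simps)
        moreover have "\<bar>S (t n) f x - f x - t n * g x\<bar> / t n \<le> e / 2"
          using est[of "t n" x] n x t[of n] by (simp add: field_simps)
        ultimately have "\<bar>(S (t n) f x - f x) / t n - g x\<bar> \<le> e / 2"
          using t[of n] by (simp add: abs_div_pos[symmetric])
        then show "dist ((S (t n) f x - f x) / t n) (g x) < e"
          using e unfolding dist_real_def by linarith
      qed
    qed
  qed
qed

lemma generator_extends_deriv0: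
  assumes f: "f \<in> Ckappa \<kappa>" and "\<exists>g. has_deriv0 \<kappa> I f g"
  shows "f \<in> generator_domain \<kappa> S" "generator \<kappa> S f = deriv0 \<kappa> I f"
proof -
  obtain g where g: "has_deriv0 \<kappa> I f g"
    using assms(2) by blast
  note gS = has_deriv0_S[OF f g]
  show "f \<in> generator_domain \<kappa> S"
    using f gS by (auto simp: generator_domain_def)
  show "generator \<kappa> S f = deriv0 \<kappa> I f"
    using deriv0_eq[OF g] deriv0_eq[OF gS] by (simp add: generator_def)
qed

section \<open>Lipschitz sets\<close>

lemma Lipschitz_set_subset: "Lipschitz_set \<kappa> I \<subseteq> Lipschitz_set \<kappa> S"
proof
  fix f assume f: "f \<in> Lipschitz_set \<kappa> I"
  then have fC: "f \<in> Ckappa \<kappa>"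
    by (simp add: Lipschitz_set_def)
  obtain C where C: "0 \<le> C"
    and lip: "\<And>s t x. s \<in> {0..1} \<Longrightarrow> t \<in> {0..1} \<Longrightarrow> \<bar>S s f x - S t f x\<bar> * \<kappa> x \<le> C * \<bar>s - t\<bar>"
    using S_time_Lipschitz[OF f zero_le_one] by metis
  have "kappa_norm \<kappa> (\<lambda>x. S t f x - f x) \<le> C * t" if "t \<in> {0..1}" for t
    using lip[OF that, of 0] that by (intro kappa_norm_least) (simp add: S_0[OF fC])
  then show "f \<in> Lipschitz_set \<kappa> S"
    using C fC unfolding Lipschitz_set_def by (blast intro: zero_less_one)
qed

text \<open>\<open>S t\<close> commutes with \<open>S s\<close> and is Lipschitz on balls.\<close>

lemma S_Lipschitz_set:
  assumes f: "f \<in> Lipschitz_set \<kappa> S" and t: "0 \<le> t"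
  shows "S t f \<in> Lipschitz_set \<kappa> S"
proof -
  obtain c t0 where c: "0 \<le> c" and t0: "0 < t0"
    and est: "\<And>t. t \<in> {0..t0} \<Longrightarrow> kappa_norm \<kappa> (\<lambda>x. S t f x - f x) \<le> c * t"
    and fC: "f \<in> Ckappa \<kappa>"
    using f by (auto simp: Lipschitz_set_def)
  define r where "r = radius (kappa_norm \<kappa> f) t0"
  define C where "C = exp (t * \<omega> (\<alpha> r t)) * c"
  note fb = Ckappa_in_ball[OF fC]
  have "kappa_norm \<kappa> (\<lambda>x. S s (S t f) x - S t f x) \<le> C * s" if s: "s \<in> {0..t0}" for s
  proof (rule kappa_norm_least)
    fix x
    have s0: "0 \<le> s" "s \<le> t0"
      using s by auto
    have Sf: "S s f \<in> Ckappa_ball \<kappa> r"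
      unfolding r_def by (rule ball_mono[OF S_radius[OF fb s0(1)] radius_mono[OF kappa_norm_nonneg[OF fC] s0]])
    have fr: "f \<in> Ckappa_ball \<kappa> r"
      unfolding r_def by (rule ball_mono[OF fb radius_ge(1)])
    have "\<bar>S s f x - f x\<bar> * \<kappa> x \<le> c * s" for x
      using kappa_norm_upper[OF Ckappa_diff[OF S_Ckappa[OF fC s0(1)] fC], of x] est[OF s] by simp
    from S_lipschitz[OF Sf fr this t, of x]
    show "\<bar>S s (S t f) x - S t f x\<bar> * \<kappa> x \<le> C * s"
      using S_semigroup[OF fC t s0(1)] S_semigroup[OF fC s0(1) t]
      by (simp add: C_def mult.assoc add.commute)
  qed
  moreover have "0 \<le> C"
    using c by (simp add: C_def)
  ultimately show ?thesis
    using S_Ckappa[OF fC t] t0 unfolding Lipschitz_set_def by blast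
qed

lemma S_kappa_norm_lipschitz:
  assumes f: "f \<in> Ckappa_ball \<kappa> r" and g: "g \<in> Ckappa_ball \<kappa> r" and t: "0 \<le> t"
  shows "kappa_norm \<kappa> (\<lambda>x. S t f x - S t g x)
    \<le> exp (t * \<omega> (\<alpha> r t)) * kappa_norm \<kappa> (\<lambda>x. f x - g x)"
  by (intro kappa_norm_least S_lipschitz[OF f g _ t] kappa_norm_upper Ckappa_diff ball_Ckappa[OF f] ball_Ckappa[OF g])

lemma S_kappa_norm_le:
  assumes f: "f \<in> Ckappa_ball \<kappa> r" and t: "0 \<le> t" and r: "t = 0 \<longrightarrow> r \<le> \<alpha> r 0"
  shows "kappa_norm \<kappa> (S t f) \<le> \<alpha> r t"
proof (cases "t = 0")
  case True
  then show ?thesis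
    using f r S_0[OF ball_Ckappa[OF f]] by (simp add: Ckappa_ball_def)
next
  case False
  then show ?thesis
    using S_alpha[OF f] t by simp
qed

end

section \<open>Generation of the semigroup\<close>

theorem theorem5p4:
  fixes \<kappa> :: "'a::polish_space \<Rightarrow> real"
    and I :: "real \<Rightarrow> ('a \<Rightarrow> real) \<Rightarrow> 'a \<Rightarrow> real"
    and h :: "nat \<Rightarrow> real"
    and \<T> :: "real set"
    and \<alpha> :: "real \<Rightarrow> real \<Rightarrow> real"
    and \<omega> :: "real \<Rightarrow> real"
    and \<D> :: "('a \<Rightarrow> real) set"
  assumes kappa: "\<And>x. 0 < \<kappa> x" "continuous_on UNIV \<kappa>" "bounded (range \<kappa>)"
    and I_maps: "operator_family \<kappa> I"
    and h: "\<And>n. 0 < h n" "h \<longlonglongrightarrow> 0"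
    and T: "\<T> \<subseteq> {0..}" "countable \<T>" "{0..} \<subseteq> closure \<T>" "0 \<in> \<T>"
    and I_zero: "\<And>f. f \<in> Ckappa \<kappa> \<Longrightarrow> I 0 f = f"
    and I_conv_mono: "\<And>n. convex_operator \<kappa> (I (h n))" "\<And>n. monotone_operator \<kappa> (I (h n))"
      "\<And>n. I (h n) (\<lambda>x. 0) = (\<lambda>x. 0)"
    and alpha_nonneg: "\<And>r t. 0 \<le> r \<Longrightarrow> 0 \<le> t \<Longrightarrow> 0 \<le> \<alpha> r t"
    and alpha_mono: "\<And>r s t. 0 \<le> r \<Longrightarrow> 0 \<le> s \<Longrightarrow> s \<le> t \<Longrightarrow> \<alpha> r s \<le> \<alpha> r t"
    and alpha_ball: "\<And>r n f. 0 \<le> r \<Longrightarrow> f \<in> Ckappa_ball \<kappa> r \<Longrightarrow>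
      I (h n) f \<in> Ckappa_ball \<kappa> (\<alpha> r (h n))"
    and alpha_comp: "\<And>r k l n. 0 \<le> r \<Longrightarrow> 1 \<le> k \<Longrightarrow> 1 \<le> l \<Longrightarrow>
      \<alpha> (\<alpha> r (real k * h n)) (real l * h n) \<le> \<alpha> r (real (k + l) * h n)"
    and omega_nonneg: "\<And>r. 0 \<le> r \<Longrightarrow> 0 \<le> \<omega> r"
    and omega_mono: "\<And>r s. 0 \<le> r \<Longrightarrow> r \<le> s \<Longrightarrow> \<omega> r \<le> \<omega> s"
    and omega_lip: "\<And>r n f g. 0 \<le> r \<Longrightarrow> f \<in> Ckappa_ball \<kappa> r \<Longrightarrow> g \<in> Ckappa_ball \<kappa> r \<Longrightarrow>
      kappa_norm \<kappa> (\<lambda>x. I (h n) f x - I (h n) g x)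
        \<le> exp (h n * \<omega> r) * kappa_norm \<kappa> (\<lambda>x. f x - g x)"
    and D: "countable \<D>" "\<D> \<subseteq> Lipschitz_set \<kappa> I"
    and D_equi: "\<And>f t. f \<in> \<D> \<Longrightarrow> t \<in> \<T> \<Longrightarrow> unif_equicontinuous (\<lambda>n. iterate I (h n) t f)"
    and D_dense: "\<And>f. f \<in> Ckappa \<kappa> \<Longrightarrow>
      \<exists>F. (\<forall>n. F n \<in> \<D>) \<and> (\<forall>n. kappa_norm \<kappa> (F n) \<le> kappa_norm \<kappa> f) \<and> mixed_lim \<kappa> F f"
    and I_tight: "\<And>\<epsilon> r T K. 0 < \<epsilon> \<Longrightarrow> 0 \<le> r \<Longrightarrow> 0 \<le> T \<Longrightarrow> compact K \<Longrightarrow>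
      \<exists>K' c. compact K' \<and> 0 \<le> c \<and>
        (\<forall>t\<in>{0..T}. \<forall>n. \<forall>f\<in>Ckappa_ball \<kappa> r. \<forall>g\<in>Ckappa_ball \<kappa> r.
           sup_norm_on K (\<lambda>x. iterate I (h n) t f x - iterate I (h n) t g x)
             \<le> c * sup_norm_on K' (\<lambda>x. f x - g x) + \<epsilon>)"
  shows "\<exists>S \<sigma>.
     convex_monotone_semigroup \<kappa> S \<and> strongly_continuous \<kappa> S \<and>
     (\<forall>t\<ge>0. S t (\<lambda>x. 0) = (\<lambda>x. 0)) \<and>
     strict_mono (\<sigma> :: nat \<Rightarrow> nat) \<and>
     (\<forall>f\<in>Ckappa \<kappa>. \<forall>t\<in>\<T>. mixed_lim \<kappa> (\<lambda>l. iterate I (h (\<sigma> l)) t f) (S t f)) \<and>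
     \<comment> \<open>(i)\<close>
     (\<forall>f\<in>Ckappa \<kappa>. (\<exists>g. has_deriv0 \<kappa> I f g) \<longrightarrow>
        f \<in> generator_domain \<kappa> S \<and> generator \<kappa> S f = deriv0 \<kappa> I f) \<and>
     \<comment> \<open>(ii); the first bound can fail at time 0 unless r \<le> \<alpha> r 0\<close>
     (\<forall>r\<ge>0. \<forall>t\<ge>0. \<forall>f\<in>Ckappa_ball \<kappa> r. \<forall>g\<in>Ckappa_ball \<kappa> r.
        ((t = 0 \<longrightarrow> r \<le> \<alpha> r 0) \<longrightarrow> kappa_norm \<kappa> (S t f) \<le> \<alpha> r t) \<and>
        kappa_norm \<kappa> (\<lambda>x. S t f x - S t g x)
          \<le> exp (t * \<omega> (\<alpha> r t)) * kappa_norm \<kappa> (\<lambda>x. f x - g x)) \<and>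
     \<comment> \<open>(iii)\<close>
     (\<forall>\<epsilon>>0. \<forall>r\<ge>0. \<forall>T\<ge>0. \<forall>K. compact K \<longrightarrow>
        (\<exists>K' c. compact K' \<and> 0 \<le> c \<and>
          (\<forall>t\<in>{0..T}. \<forall>f\<in>Ckappa_ball \<kappa> r. \<forall>g\<in>Ckappa_ball \<kappa> r.
             sup_norm_on K (\<lambda>x. S t f x - S t g x)
               \<le> c * sup_norm_on K' (\<lambda>x. f x - g x) + \<epsilon>))) \<and>
     \<comment> \<open>(iv)\<close>
     Lipschitz_set \<kappa> I \<subseteq> Lipschitz_set \<kappa> S \<and>
     (\<forall>t\<ge>0. \<forall>f\<in>Lipschitz_set \<kappa> S. S t f \<in> Lipschitz_set \<kappa> S)"
proof -
  have scheme: "iteration_scheme \<kappa> I h' \<alpha> \<omega> \<D>" if h': "h' = (\<lambda>l. h (\<sigma> l))" "h' \<longlonglongrightarrow> 0" for h' \<sigma>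
  proof (unfold_locales)
    show "0 < \<kappa> x" for x by (rule kappa(1))
    show "continuous_on UNIV \<kappa>" by (rule kappa(2))
    show "operator_family \<kappa> I" by (rule I_maps)
    show "h' \<longlonglongrightarrow> 0" by (rule h'(2))
    show "I 0 f = f" if "f \<in> Ckappa \<kappa>" for f by (rule I_zero[OF that])
    show "\<D> \<subseteq> Lipschitz_set \<kappa> I" by (rule D(2))
  next
    fix \<epsilon> r T :: real and K :: "'a set"
    assume "0 < \<epsilon>" "0 \<le> r" "0 \<le> T" "compact K"
    from I_tight[OF this] show "\<exists>K' c. compact K' \<and> 0 \<le> c \<and>
        (\<forall>t\<in>{0..T}. \<forall>n. \<forall>f\<in>Ckappa_ball \<kappa> r. \<forall>g\<in>Ckappa_ball \<kappa> r.
           sup_norm_on K (\<lambda>x. iterate I (h' n) t f x - iterate I (h' n) t g x)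
             \<le> c * sup_norm_on K' (\<lambda>x. f x - g x) + \<epsilon>)"
      unfolding h'(1) by blast
  qed (simp_all add: h'(1) h(1) I_conv_mono alpha_nonneg alpha_mono alpha_ball alpha_comp[simplified]
      omega_nonneg omega_mono omega_lip D_dense)
  interpret A: iteration_scheme \<kappa> I h \<alpha> \<omega> \<D>
    by (rule scheme[of h id]) (simp_all add: h(2))
  obtain Q :: "'a set" where Q: "countable Q" "\<And>U. open U \<Longrightarrow> U \<noteq> {} \<Longrightarrow> \<exists>q\<in>Q. q \<in> U"
    by (rule countable_dense_setE) blast
  obtain \<sigma> :: "nat \<Rightarrow> nat" where \<sigma>: "strict_mono \<sigma>"
    and conv: "\<And>f t q. f \<in> \<D> \<Longrightarrow> t \<in> \<T> \<Longrightarrow> q \<in> Q \<Longrightarrow> convergent (\<lambda>l. iterate I (h (\<sigma> l)) t f q)"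
    using A.pointwise_convergent_subsequence[OF D(1) T(2,1) Q(1)] by blast
  define S where "S t f = (\<lambda>x. lim (\<lambda>l. iterate I (h (\<sigma> l)) t f x))" for t f
  have cauchy: "uniformly_Cauchy_on K (\<lambda>l. iterate I (h (\<sigma> l)) t f)"
    if "f \<in> Ckappa \<kappa>" "0 \<le> t" "compact K" for f t K
  proof (rule A.iterates_Cauchy_all_functions[OF that])
    fix g assume g: "g \<in> \<D>"
    show "uniformly_Cauchy_on K (\<lambda>l. iterate I (h (\<sigma> l)) t g)"
    proof (rule A.iterates_Cauchy_all_times[OF \<sigma> _ that(3) T(1,3) _ that(2)])
      show "g \<in> Lipschitz_set \<kappa> I"
        using g D(2) by blast
      fix s assume s: "s \<in> \<T>"
      have "unif_equicontinuous (\<lambda>l. iterate I (h (\<sigma> l)) s g)"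
        using D_equi[OF g s] unfolding unif_equicontinuous_def by meson
      then show "uniformly_Cauchy_on K (\<lambda>l. iterate I (h (\<sigma> l)) s g)"
        using Q(2) conv[OF g s] that(3) by (rule equicontinuous_imp_uniformly_Cauchy)
    qed
  qed
  have lim: "mixed_lim \<kappa> (\<lambda>l. iterate I (h (\<sigma> l)) t f) (S t f)" if "f \<in> Ckappa \<kappa>" "0 \<le> t" for f t
    unfolding S_def by (rule A.mixed_lim_if_Cauchy[OF that cauchy[OF that]])
  have "(\<lambda>l. h (\<sigma> l)) \<longlonglongrightarrow> 0"
    using LIMSEQ_subseq_LIMSEQ[OF h(2) \<sigma>] by (simp add: comp_def)
  then interpret B: iteration_scheme \<kappa> I "\<lambda>l. h (\<sigma> l)" \<alpha> \<omega> \<D>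
    by (rule scheme[OF refl])
  interpret B: iteration_limit \<kappa> I "\<lambda>l. h (\<sigma> l)" \<alpha> \<omega> \<D> S
    by unfold_locales (rule lim)
  show ?thesis
  proof (intro exI[of _ S] exI[of _ \<sigma>] conjI)
    show "convex_monotone_semigroup \<kappa> S"
      by (rule B.S_convex_monotone_semigroup)
    show "strongly_continuous \<kappa> S"
      by (rule B.S_strongly_continuous)
    show "\<forall>t\<ge>0. S t (\<lambda>x. 0) = (\<lambda>x. 0)"
      using B.S_zero by blast
    show "strict_mono \<sigma>"
      by (rule \<sigma>)
    show "\<forall>f\<in>Ckappa \<kappa>. \<forall>t\<in>\<T>. mixed_lim \<kappa> (\<lambda>l. iterate I (h (\<sigma> l)) t f) (S t f)"
      using lim T(1) by auto
    show "\<forall>f\<in>Ckappa \<kappa>. (\<exists>g. has_deriv0 \<kappa> I f g) \<longrightarrow>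
        f \<in> generator_domain \<kappa> S \<and> generator \<kappa> S f = deriv0 \<kappa> I f"
      using B.generator_extends_deriv0 by blast
    show "\<forall>r\<ge>0. \<forall>t\<ge>0. \<forall>f\<in>Ckappa_ball \<kappa> r. \<forall>g\<in>Ckappa_ball \<kappa> r.
        ((t = 0 \<longrightarrow> r \<le> \<alpha> r 0) \<longrightarrow> kappa_norm \<kappa> (S t f) \<le> \<alpha> r t) \<and>
        kappa_norm \<kappa> (\<lambda>x. S t f x - S t g x)
          \<le> exp (t * \<omega> (\<alpha> r t)) * kappa_norm \<kappa> (\<lambda>x. f x - g x)"
      using B.S_kappa_norm_le B.S_kappa_norm_lipschitz by blast
    show "\<forall>\<epsilon>>0. \<forall>r\<ge>0. \<forall>T\<ge>0. \<forall>K. compact K \<longrightarrow>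
        (\<exists>K' c. compact K' \<and> 0 \<le> c \<and>
          (\<forall>t\<in>{0..T}. \<forall>f\<in>Ckappa_ball \<kappa> r. \<forall>g\<in>Ckappa_ball \<kappa> r.
             sup_norm_on K (\<lambda>x. S t f x - S t g x)
               \<le> c * sup_norm_on K' (\<lambda>x. f x - g x) + \<epsilon>))"
      using B.S_tight by blast
    show "Lipschitz_set \<kappa> I \<subseteq> Lipschitz_set \<kappa> S"
      by (rule B.Lipschitz_set_subset)
    show "\<forall>t\<ge>0. \<forall>f\<in>Lipschitz_set \<kappa> S. S t f \<in> Lipschitz_set \<kappa> S"
      using B.S_Lipschitz_set by blast
  qed
qed

end
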